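(* Let $A$ be a finite set with $|A|>1$, let $\mathbf{B}=(B,\mathcal{F})$ be an algebra with $|B|=2$, and let $\mathcal{C}_{A,\mathbf{B}}$ denote the set of all clonoids with source set $A$ and target algebra $\mathbf{B}$. Then: (1) $\mathcal{C}_{A,\mathbf{B}}$ is finite if and only if $\mathbf{B}$ has an NU-term; (2) $\mathcal{C}_{A,\mathbf{B}}$ is countably infinite if and only if $\mathbf{B}$ has a Mal'cev term but no majority term; (3) $\mathcal{C}_{A,\mathbf{B}}$ has the cardinality of the continuum if and only if $\mathbf{B}$ has neither an NU-term nor a Mal'cev term. Moreover, in cases (1) and (2) all clonoids in $\mathcal{C}_{A,\mathbf{B}}$ are finitely related.
   Context: $\mathbb{N}=\{1,2,\dots\}$ and $[k]=\{1,\dots,k\}$. An algebra $\mathbf{B}=(B,\mathcal{F})$ is a set $B$ with a (possibly empty, possibly infinite) set $\mathcal{F}$ of finitary operations on $B$; its term operations are the operations obtained from projections and $\mathcal{F}$ by composition. Minors: for $f\colon A^k\to B$, $\ell\in\mathbb{N}$ and $\sigma\colon[k]\to[\ell]$, the function $f^\sigma\colon A^\ell\to B$, $(x_1,\dots,x_\ell)\mapsto f(x_{\sigma(1)},\dots,x_{\sigma(k)})$ is a minor of $f$. Clonoids: for $C\subseteq\bigcup_{n\in\mathbb{N}}B^{A^n}$ let $C_k:=C\cap B^{A^k}$. $C$ is a clonoid with source set $A$ and target algebra $\mathbf{B}$ if $C$ is closed under taking minors and, for all $k\in\mathbb{N}$, $C_k$ is a subalgebra of $\mathbf{B}^{A^k}$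 (i.e. closed under the pointwise operations of $\mathbf{B}$; the empty set is allowed). Polymorphisms: for $m$-ary relations $P\subseteq A^m$, $Q\subseteq B^m$, a function $f\colon A^k\to B$ is a polymorphism of $(P,Q)$ if $f$ applied componentwise to any $k$-tuple of elements of $P$ gives an element of $Q$. For a set $R=\{(P_i,Q_i) : i\in I\}$ of such pairs (arities may vary with $i$), $\mathrm{Pol}(R)$ is the set of all functions (of all arities $k\in\mathbb{N}$) that are polymorphisms of every pair in $R$. A clonoid $C$ with source set $A$ and target algebra $\mathbf{B}$ is finitely related if $C=\mathrm{Pol}(R)$ for some finite set $R$ of pairs of finitary relations on $A$ and $B$. Terms: a near-unanimity (NU) term of $\mathbf{B}$ is a $k$-ary term operation $f$, for some $k\ge 3$, with $f(y,x,x,\dots,x)=f(x,y,x,\dots,x)=\dots=f(x,\dots,x,y)=x$ for all $x,y\in B$. A majority term is a ternary NU-term. A Mal'cev term of $\mathbf{B}$ is a ternary term operation $f$ with $f(y,y,x)=f(x,y,y)=x$ for all $x,y\in B$. *)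

theory Defs
  imports Complex_Main "HOL-Library.FuncSet" "HOL-Library.Countable_Set"
    "HOL-Library.Equipollence" "HOL-Library.Cardinality"
begin

text \<open>
  The source set and the universe of the target algebra are the types \<open>'a\<close> and \<open>'b\<close>; a
  \<open>k\<close>-tuple is a list of length \<open>k\<close>, with indices starting at 0. A \<open>k\<close>-ary function is a pair
  \<open>(k, f)\<close> with \<open>f\<close> extensional on the \<open>k\<close>-tuples. The arity has to be recorded, because
  extensional functions on tuples of different lengths may coincide as HOL functions, but in
  this way distinct pairs are distinct functions, so that cardinalities of sets of functions
  are the intended ones.
\<close>

definition tuples :: "nat \<Rightarrow> 'c list set" where
  "tuples k = {xs. length xs = k}"

definition finitary_functions :: "(nat \<times> ('a list \<Rightarrow> 'b)) set" where
  "finitary_functions = (SIGMA k:{1..}. tuples k \<rightarrow>\<^sub>E UNIV)"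

text \<open>Basic operations may be nullary.\<close>

definition algebra_ops :: "(nat \<times> ('b list \<Rightarrow> 'b)) set \<Rightarrow> bool" where
  "algebra_ops F \<longleftrightarrow> F \<subseteq> (SIGMA n:UNIV. tuples n \<rightarrow>\<^sub>E UNIV)"

definition minor :: "nat \<Rightarrow> nat \<Rightarrow> (nat \<Rightarrow> nat) \<Rightarrow> ('a list \<Rightarrow> 'b) \<Rightarrow> 'a list \<Rightarrow> 'b" where
  "minor k l \<sigma> f = (\<lambda>xs\<in>tuples l. f (map (\<lambda>i. xs ! \<sigma> i) [0..<k]))"

text \<open>
  \<open>pointwise k g [f\<^sub>1, \<dots>, f\<^sub>n]\<close> is the \<open>k\<close>-ary function \<open>g(f\<^sub>1, \<dots>, f\<^sub>n)\<close>.
\<close>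

definition pointwise ::
    "nat \<Rightarrow> ('b list \<Rightarrow> 'c) \<Rightarrow> ('a list \<Rightarrow> 'b) list \<Rightarrow> 'a list \<Rightarrow> 'c" where
  "pointwise k g fs = (\<lambda>xs\<in>tuples k. g (map (\<lambda>f. f xs) fs))"

definition clonoid ::
    "(nat \<times> ('b list \<Rightarrow> 'b)) set \<Rightarrow> (nat \<times> ('a list \<Rightarrow> 'b)) set \<Rightarrow> bool" where
  "clonoid F C \<longleftrightarrow>
     C \<subseteq> finitary_functions \<and>
     (\<forall>(k, f) \<in> C. \<forall>l\<ge>1. \<forall>\<sigma> \<in> {..<k} \<rightarrow> {..<l}. (l, minor k l \<sigma> f) \<in> C) \<and>
     (\<forall>k\<ge>1. \<forall>(n, g) \<in> F. \<forall>fs. length fs = n \<and> (\<forall>f\<in>set fs. (k, f) \<in> C) \<longrightarrow>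
        (k, pointwise k g fs) \<in> C)"

definition clonoids ::
    "(nat \<times> ('b list \<Rightarrow> 'b)) set \<Rightarrow> (nat \<times> ('a list \<Rightarrow> 'b)) set set" where
  "clonoids F = {C. clonoid F C}"

definition polymorphism ::
    "nat \<Rightarrow> 'a list set \<Rightarrow> 'b list set \<Rightarrow> nat \<Rightarrow> ('a list \<Rightarrow> 'b) \<Rightarrow> bool" where
  "polymorphism m P Q k f \<longleftrightarrow>
     (\<forall>ps. length ps = k \<and> set ps \<subseteq> P \<longrightarrow>
        map (\<lambda>j. f (map (\<lambda>p. p ! j) ps)) [0..<m] \<in> Q)"

text \<open>A pair of \<open>m\<close>-ary relations \<open>(P, Q)\<close> is represented by the triple \<open>(m, P, Q)\<close>.\<close>

definition relation_pairs :: "(nat \<times> 'a list set \<times> 'b list set) set" where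
  "relation_pairs = {(m, P, Q). m \<ge> 1 \<and> P \<subseteq> tuples m \<and> Q \<subseteq> tuples m}"

definition Pol ::
    "(nat \<times> 'a list set \<times> 'b list set) set \<Rightarrow> (nat \<times> ('a list \<Rightarrow> 'b)) set" where
  "Pol R = {(k, f) \<in> finitary_functions. \<forall>(m, P, Q) \<in> R. polymorphism m P Q k f}"

definition finitely_related :: "(nat \<times> ('a list \<Rightarrow> 'b)) set \<Rightarrow> bool" where
  "finitely_related C \<longleftrightarrow> (\<exists>R. finite R \<and> R \<subseteq> relation_pairs \<and> C = Pol R)"

inductive_set term_ops :: "(nat \<times> ('b list \<Rightarrow> 'b)) set \<Rightarrow> (nat \<times> ('b list \<Rightarrow> 'b)) set"
  for F :: "(nat \<times> ('b list \<Rightarrow> 'b)) set" where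
  proj: "i < k \<Longrightarrow> (k, \<lambda>xs\<in>tuples k. xs ! i) \<in> term_ops F"
| comp: "k \<ge> 1 \<Longrightarrow> (n, g) \<in> F \<Longrightarrow> length fs = n \<Longrightarrow> \<forall>f\<in>set fs. (k, f) \<in> term_ops F \<Longrightarrow>
    (k, pointwise k g fs) \<in> term_ops F"

definition nu_operation :: "nat \<Rightarrow> ('b list \<Rightarrow> 'b) \<Rightarrow> bool" where
  "nu_operation k f \<longleftrightarrow> k \<ge> 3 \<and> (\<forall>x y. \<forall>i<k. f ((replicate k x)[i := y]) = x)"

definition has_nu_term :: "(nat \<times> ('b list \<Rightarrow> 'b)) set \<Rightarrow> bool" where
  "has_nu_term F \<longleftrightarrow> (\<exists>(k, f) \<in> term_ops F. nu_operation k f)"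

definition has_majority_term :: "(nat \<times> ('b list \<Rightarrow> 'b)) set \<Rightarrow> bool" where
  "has_majority_term F \<longleftrightarrow> (\<exists>f. (3, f) \<in> term_ops F \<and> nu_operation 3 f)"

definition has_malcev_term :: "(nat \<times> ('b list \<Rightarrow> 'b)) set \<Rightarrow> bool" where
  "has_malcev_term F \<longleftrightarrow>
     (\<exists>f. (3, f) \<in> term_ops F \<and> (\<forall>x y. f [y, y, x] = x \<and> f [x, y, y] = x))"

end

theory Submission
  imports Defs "HOL-Library.Sublist" "HOL-Analysis.Abstract_Topology_2"
begin

text \<open>
  Near-unanimity terms. By the argument of Baker and Pixley, a near-unanimity term of arity
  \<open>d + 1\<close> forces a clonoid to be determined by its invariant pairs of arity at most \<open>d\<close>, of which
  there are finitely many.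

  Mal'cev terms. On two elements a Mal'cev term yields a majority term or the minority
  \<open>x + y + z\<close>. In the latter case a clonoid is determined, inside a larger one, by its forks: the
  words \<open>w\<close> over \<open>A\<close> for which two members of the clonoid agree on all lexicographically smaller words
  and differ at \<open>w\<close> (echelon form). Forks are closed downwards under an embedding order that is a
  well-quasi-order by Higman's lemma, so the approximations of a clonoid by its invariant pairs of
  bounded arity become stationary. Without a majority term all term operations are affine, and then
  the functions of degree at most \<open>d\<close> form an infinite chain of clonoids.

  Neither. Call the two elements 0 and 1. If no term operation \<open>g\<close> with \<open>g(0,...,0) = 0\<close> escapes all
  inequalities \<open>g \<le> x\<^sub>i\<close>, the indicator functions of the sets of unit vectors are independent,
  whence a continuum of clonoids; dually for 0 and 1 exchanged. If both conditions fail, two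
  escaping term operations can be combined to a near-unanimity or a Mal'cev term.
\<close>

subsection \<open>Term operations, clonoids and polymorphisms\<close>

lemma tuples_iff [simp]: "xs \<in> tuples k \<longleftrightarrow> length xs = k"
  by (simp add: tuples_def)

lemma finite_tuples: "finite (UNIV :: 'c set) \<Longrightarrow> finite (tuples k :: 'c list set)"
  using finite_lists_length_eq[of "UNIV :: 'c set" k] by (simp add: tuples_def)

lemma finitary_functions_iff:
  "(k, f) \<in> finitary_functions \<longleftrightarrow> k \<ge> 1 \<and> f \<in> extensional (tuples k)"
  by (auto simp: finitary_functions_def PiE_def)

lemma finitary_functions_eqI:
  assumes "(k, f) \<in> finitary_functions" "(k, g) \<in> finitary_functions"
    and "\<And>xs. length xs = k \<Longrightarrow> f xs = g xs"
  shows "f = g"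
  using assms by (intro extensionalityI[of _ "tuples k"]) (auto simp: finitary_functions_iff)

lemma restrict_in_finitary_functions:
  "k \<ge> 1 \<Longrightarrow> (k, restrict f (tuples k)) \<in> finitary_functions"
  by (simp add: finitary_functions_iff)

lemma pointwise_apply [simp]:
  "length xs = k \<Longrightarrow> pointwise k g fs xs = g (map (\<lambda>f. f xs) fs)"
  by (simp add: pointwise_def)

lemma pointwise_in_finitary_functions:
  "k \<ge> 1 \<Longrightarrow> (k, pointwise k g fs) \<in> finitary_functions"
  unfolding pointwise_def by (rule restrict_in_finitary_functions)

lemma minor_apply [simp]:
  "length xs = l \<Longrightarrow> minor k l \<sigma> f xs = f (map (\<lambda>i. xs ! \<sigma> i) [0..<k])"
  by (simp add: minor_def)

lemma minor_in_finitary_functions: "l \<ge> 1 \<Longrightarrow> (l, minor k l \<sigma> f) \<in> finitary_functions"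
  unfolding minor_def by (rule restrict_in_finitary_functions)

lemma term_ops_finitary: "term_ops F \<subseteq> finitary_functions"
proof -
  have "(k, f) \<in> term_ops F \<Longrightarrow> (k, f) \<in> finitary_functions" for k f
    by (induction rule: term_ops.induct)
      (simp_all add: restrict_in_finitary_functions pointwise_in_finitary_functions del: restrict_apply)
  then show ?thesis by auto
qed

lemma term_ops_arity: "(k, f) \<in> term_ops F \<Longrightarrow> k \<ge> 1"
  using term_ops_finitary by (fastforce simp: finitary_functions_iff)

text \<open>Structural induction on the term operation \<open>g\<close>. Closure under the basic
  operations is asked at the one arity \<open>k\<close>, so that the result serves clonoids as well
  as \<open>term_ops\<close> itself.\<close>

lemma pointwise_term_op_closed:
  assumes fin: "C \<subseteq> finitary_functions" and k: "k \<ge> 1"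
    and cl: "\<And>n g fs. (n, g) \<in> F \<Longrightarrow> length fs = n \<Longrightarrow> \<forall>f\<in>set fs. (k, f) \<in> C \<Longrightarrow>
      (k, pointwise k g fs) \<in> C"
    and g: "(n, g) \<in> term_ops F" and fs: "length fs = n" "\<forall>f\<in>set fs. (k, f) \<in> C"
  shows "(k, pointwise k g fs) \<in> C"
  using g fs(1)
proof (induction rule: term_ops.induct)
  case (proj i n)
  then have "(k, fs ! i) \<in> C" using fs(2) by simp
  moreover have "pointwise k (\<lambda>xs\<in>tuples n. xs ! i) fs = fs ! i"
    using proj calculation fin k
    by (intro finitary_functions_eqI[of k]) (auto simp: pointwise_in_finitary_functions)
  ultimately show ?case by (simp del: restrict_apply)
next
  case (comp n' n g gs)
  have "(k, pointwise k g (map (\<lambda>h. pointwise k h fs) gs)) \<in> C"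
    using comp by (intro cl) auto
  moreover have "pointwise k g (map (\<lambda>h. pointwise k h fs) gs) = pointwise k (pointwise n' g gs) fs"
    using comp.prems k
    by (intro finitary_functions_eqI[of k]) (auto simp: pointwise_in_finitary_functions o_def)
  ultimately show ?case by simp
qed

lemma clonoid_finitary: "clonoid F C \<Longrightarrow> C \<subseteq> finitary_functions"
  by (simp add: clonoid_def)

lemma clonoid_arity: "clonoid F C \<Longrightarrow> (k, f) \<in> C \<Longrightarrow> k \<ge> 1"
  using clonoid_finitary by (fastforce simp: finitary_functions_iff)

lemma clonoid_minor:
  "clonoid F C \<Longrightarrow> (k, f) \<in> C \<Longrightarrow> l \<ge> 1 \<Longrightarrow> (\<And>i. i < k \<Longrightarrow> \<sigma> i < l) \<Longrightarrow> (l, minor k l \<sigma> f) \<in> C"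
  unfolding clonoid_def by (fastforce simp: Pi_def)

lemma clonoid_op:
  assumes "clonoid F C" "k \<ge> 1" "(n, g) \<in> F" "length fs = n" "\<forall>f\<in>set fs. (k, f) \<in> C"
  shows "(k, pointwise k g fs) \<in> C"
proof -
  have "\<forall>(n, g)\<in>F. \<forall>fs. length fs = n \<and> (\<forall>f\<in>set fs. (k, f) \<in> C) \<longrightarrow> (k, pointwise k g fs) \<in> C"
    using assms(1,2) by (simp add: clonoid_def)
  then show ?thesis using assms(3-5) by blast
qed

lemma clonoid_term_op:
  assumes "clonoid F C" "(n, g) \<in> term_ops F" "length fs = n" "\<forall>f\<in>set fs. (k, f) \<in> C" "k \<ge> 1"
  shows "(k, pointwise k g fs) \<in> C"
  by (rule pointwise_term_op_closed[where F = F and n = n, OF clonoid_finitary[OF assms(1)]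
        assms(5) clonoid_op[OF assms(1,5)]]) (use assms in auto)

text \<open>The functions in \<open>term_ops\<close> are extensional. This predicate looks only at
  values on \<open>k\<close>-tuples, so that plain lambda terms can be composed.\<close>

definition term_fn :: "(nat \<times> ('b list \<Rightarrow> 'b)) set \<Rightarrow> nat \<Rightarrow> ('b list \<Rightarrow> 'b) \<Rightarrow> bool" where
  "term_fn F k f \<longleftrightarrow> (k, restrict f (tuples k)) \<in> term_ops F"

lemma term_fn_of_op: "(k, f) \<in> term_ops F \<Longrightarrow> term_fn F k f"
proof -
  assume f: "(k, f) \<in> term_ops F"
  then have "restrict f (tuples k) = f"
    using term_ops_finitary by (metis extensional_restrict finitary_functions_iff subsetD)
  with f show ?thesis by (simp add: term_fn_def)
qed

lemma term_fn_arity: "term_fn F k f \<Longrightarrow> k \<ge> 1"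
  unfolding term_fn_def by (rule term_ops_arity)

lemma term_fn_proj: "i < k \<Longrightarrow> term_fn F k (\<lambda>xs. xs ! i)"
  unfolding term_fn_def by (rule term_ops.proj)

lemma term_fn_cong:
  "term_fn F k f \<Longrightarrow> (\<And>xs. length xs = k \<Longrightarrow> f xs = g xs) \<Longrightarrow> term_fn F k g"
proof -
  assume f: "term_fn F k f" and eq: "\<And>xs. length xs = k \<Longrightarrow> f xs = g xs"
  have "restrict f (tuples k) = restrict g (tuples k)" by (rule restrict_ext) (simp add: eq)
  with f show ?thesis by (simp only: term_fn_def)
qed

lemma term_fn_comp:
  assumes g: "term_fn F n g" and k: "k \<ge> 1" and h: "\<And>i. i < n \<Longrightarrow> term_fn F k (h i)"
  shows "term_fn F k (\<lambda>xs. g (map (\<lambda>i. h i xs) [0..<n]))"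
proof -
  let ?fs = "map (\<lambda>i. restrict (h i) (tuples k)) [0..<n]"
  have "(k, pointwise k (restrict g (tuples n)) ?fs) \<in> term_ops F"
  proof (rule pointwise_term_op_closed[where F = F and n = n, OF term_ops_finitary k])
    show "(k, pointwise k g' fs) \<in> term_ops F"
      if "(n', g') \<in> F" "length fs = n'" "\<forall>f\<in>set fs. (k, f) \<in> term_ops F" for n' g' fs
      using k that by (rule term_ops.comp)
  qed (use g h in \<open>auto simp: term_fn_def simp del: restrict_apply\<close>)
  moreover have "pointwise k (restrict g (tuples n)) ?fs
      = restrict (\<lambda>xs. g (map (\<lambda>i. h i xs) [0..<n])) (tuples k)"
    by (rule extensionalityI[of _ "tuples k"]) (simp_all add: pointwise_def o_def)
  ultimately show ?thesis by (simp only: term_fn_def)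
qed

definition term2 where "term2 F f \<longleftrightarrow> term_fn F 2 (\<lambda>xs. f (xs ! 0) (xs ! 1))"
definition term3 where "term3 F f \<longleftrightarrow> term_fn F 3 (\<lambda>xs. f (xs ! 0) (xs ! 1) (xs ! 2))"

lemma term_fn_comp2:
  assumes "term2 F f" "term_fn F k a" "term_fn F k b"
  shows "term_fn F k (\<lambda>xs. f (a xs) (b xs))"
proof -
  have "term_fn F k (\<lambda>xs. (\<lambda>ys. f (ys ! 0) (ys ! 1)) (map (\<lambda>i. (if i = 0 then a else b) xs) [0..<2]))"
    using assms term_fn_arity[OF assms(2)] by (intro term_fn_comp) (auto simp: term2_def)
  then show ?thesis by (simp add: upt_conv_Cons)
qed

lemma term_fn_comp3:
  assumes "term3 F f" "term_fn F k a" "term_fn F k b" "term_fn F k c"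
  shows "term_fn F k (\<lambda>xs. f (a xs) (b xs) (c xs))"
proof -
  have "term_fn F k (\<lambda>xs. (\<lambda>ys. f (ys ! 0) (ys ! 1) (ys ! 2))
      (map (\<lambda>i. (if i = 0 then a else if i = 1 then b else c) xs) [0..<3]))"
    using assms term_fn_arity[OF assms(2)] by (intro term_fn_comp) (auto simp: term3_def)
  then show ?thesis by (simp add: upt_conv_Cons)
qed

lemma clonoid_term3:
  assumes "clonoid F C" "term3 F t" "(k, f) \<in> C" "(k, g) \<in> C" "(k, h) \<in> C"
  shows "(k, \<lambda>xs\<in>tuples k. t (f xs) (g xs) (h xs)) \<in> C"
proof -
  have "(k, pointwise k (\<lambda>ys\<in>tuples 3. t (ys ! 0) (ys ! 1) (ys ! 2)) [f, g, h]) \<in> C"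
  proof (rule clonoid_term_op[OF assms(1), where n = 3])
    show "(3, \<lambda>ys\<in>tuples 3. t (ys ! 0) (ys ! 1) (ys ! 2)) \<in> term_ops F"
      using assms(2) unfolding term3_def term_fn_def .
  qed (use assms clonoid_arity[OF assms(1,3)] in simp_all)
  then show ?thesis by (simp add: pointwise_def)
qed

lemma clonoidI:
  assumes "C \<subseteq> finitary_functions"
    and "\<And>k f l \<sigma>. (k, f) \<in> C \<Longrightarrow> l \<ge> 1 \<Longrightarrow> (\<And>i. i < k \<Longrightarrow> \<sigma> i < l) \<Longrightarrow> (l, minor k l \<sigma> f) \<in> C"
    and "\<And>k n g fs. k \<ge> 1 \<Longrightarrow> (n, g) \<in> F \<Longrightarrow> length fs = n \<Longrightarrow> (\<And>f. f \<in> set fs \<Longrightarrow> (k, f) \<in> C) \<Longrightarrow>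
      (k, pointwise k g fs) \<in> C"
  shows "clonoid F C"
  unfolding clonoid_def
proof (intro conjI)
  show "\<forall>(k, f)\<in>C. \<forall>l\<ge>1. \<forall>\<sigma>\<in>{..<k} \<rightarrow> {..<l}. (l, minor k l \<sigma> f) \<in> C"
    using assms(2) by (auto simp: Pi_def)
  show "\<forall>k\<ge>1. \<forall>(n, g)\<in>F. \<forall>fs. length fs = n \<and> (\<forall>f\<in>set fs. (k, f) \<in> C) \<longrightarrow>
      (k, pointwise k g fs) \<in> C"
    using assms(3) by (auto simp del: pointwise_apply)
qed (rule assms(1))

text \<open>Passing to a minor only rearranges and repeats the tuples drawn from \<open>P\<close>.
  For a pointwise operation, the arguments produce tuples in \<open>Q\<close>, which the basic
  operations preserve.\<close>

lemma clonoid_Pol: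
  assumes "\<And>m P Q n g. (m, P, Q) \<in> R \<Longrightarrow> (n, g) \<in> F \<Longrightarrow> polymorphism m Q Q n g"
  shows "clonoid F (Pol R)"
proof (rule clonoidI)
  show "Pol R \<subseteq> finitary_functions" by (auto simp: Pol_def)
next
  fix k f l \<sigma> assume f: "(k, f) \<in> Pol R" and l: "1 \<le> (l::nat)" and \<sigma>: "\<And>i. i < k \<Longrightarrow> \<sigma> i < l"
  have "polymorphism m P Q l (minor k l \<sigma> f)" if R: "(m, P, Q) \<in> R" for m P Q
    unfolding polymorphism_def
  proof (intro allI impI)
    fix ps assume ps: "length ps = l \<and> set ps \<subseteq> P"
    let ?qs = "map (\<lambda>i. ps ! \<sigma> i) [0..<k]"
    have "set ?qs \<subseteq> P" using ps \<sigma> by force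
    moreover have "polymorphism m P Q k f" using f R by (auto simp: Pol_def)
    ultimately have "map (\<lambda>j. f (map (\<lambda>p. p ! j) ?qs)) [0..<m] \<in> Q"
      unfolding polymorphism_def by (elim allE[of _ ?qs] mp) simp
    moreover have "map (\<lambda>j. f (map (\<lambda>p. p ! j) ?qs)) [0..<m]
      = map (\<lambda>j. minor k l \<sigma> f (map (\<lambda>p. p ! j) ps)) [0..<m]"
    proof -
      have "map (\<lambda>p. p ! j) ?qs = map (\<lambda>i. map (\<lambda>p. p ! j) ps ! \<sigma> i) [0..<k]" for j
        using \<sigma> ps by auto
      then show ?thesis using ps by (simp only: minor_apply length_map)
    qed
    ultimately show "map (\<lambda>j. minor k l \<sigma> f (map (\<lambda>p. p ! j) ps)) [0..<m] \<in> Q" by (simp only:)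
  qed
  then show "(l, minor k l \<sigma> f) \<in> Pol R"
    using l by (auto simp: Pol_def minor_in_finitary_functions)
next
  fix k n g and fs :: "('a list \<Rightarrow> 'b) list"
  assume k: "1 \<le> k" and g: "(n, g) \<in> F" and n: "length fs = n" and fs: "\<And>f. f \<in> set fs \<Longrightarrow> (k, f) \<in> Pol R"
  have "polymorphism m P Q k (pointwise k g fs)" if R: "(m, P, Q) \<in> R" for m P Q
    unfolding polymorphism_def
  proof (intro allI impI)
    fix ps assume ps: "length ps = k \<and> set ps \<subseteq> P"
    let ?qs = "map (\<lambda>f. map (\<lambda>j. f (map (\<lambda>p. p ! j) ps)) [0..<m]) fs"
    have "set ?qs \<subseteq> Q" using fs R ps by (fastforce simp: Pol_def polymorphism_def)
    then have "map (\<lambda>j. g (map (\<lambda>q. q ! j) ?qs)) [0..<m] \<in> Q"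
      using assms[OF R g] n unfolding polymorphism_def by (elim allE[of _ ?qs] mp) simp
    moreover have "map (\<lambda>j. pointwise k g fs (map (\<lambda>p. p ! j) ps)) [0..<m]
        = map (\<lambda>j. g (map (\<lambda>q. q ! j) ?qs)) [0..<m]"
      using ps by (intro map_cong) (auto intro!: arg_cong[where f = g])
    ultimately show "map (\<lambda>j. pointwise k g fs (map (\<lambda>p. p ! j) ps)) [0..<m] \<in> Q"
      by (simp only:)
  qed
  then show "(k, pointwise k g fs) \<in> Pol R"
    using k by (auto simp: Pol_def pointwise_in_finitary_functions)
qed

section \<open>Invariant pairs from values at finitely many points\<close>

definition columns :: "nat \<Rightarrow> 'a list list \<Rightarrow> 'a list set" where
  "columns k xs = {map (\<lambda>x. x ! i) xs | i. i < k}"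

text \<open>With the points \<open>xs\<close> as rows, the columns are the value vectors of the
  projections at \<open>xs\<close>. The pair is chosen so that a \<open>k\<close>-ary function
  preserving it agrees on \<open>xs\<close> with a member of \<open>C\<close>.\<close>

definition graph_pair ::
    "(nat \<times> ('a list \<Rightarrow> 'b)) set \<Rightarrow> nat \<Rightarrow> 'a list list \<Rightarrow> nat \<times> 'a list set \<times> 'b list set" where
  "graph_pair C k xs = (length xs, columns k xs, {map g xs | g. (k, g) \<in> C})"

definition graph_pairs ::
    "(nat \<times> ('a list \<Rightarrow> 'b)) set \<Rightarrow> nat \<Rightarrow> (nat \<times> 'a list set \<times> 'b list set) set" where
  "graph_pairs C n =
    {graph_pair C k xs | k xs. k \<ge> 1 \<and> xs \<noteq> [] \<and> length xs \<le> n \<and> set xs \<subseteq> tuples k}"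

lemma graph_pairs_bounded:
  "graph_pairs C n \<subseteq> (SIGMA m:{1..n}. Pow (tuples m) \<times> Pow (tuples m))"
  by (auto simp: graph_pairs_def graph_pair_def columns_def Suc_le_eq)

text \<open>Choosing columns amounts to a map \<open>\<sigma>\<close> from the arguments of
  \<open>f\<close> to the coordinates, and applying \<open>f\<close> to these columns evaluates a
  minor of \<open>f\<close>, again in \<open>C\<close>, at the points.\<close>

lemma clonoid_subset_Pol_graph_pairs:
  assumes C: "clonoid F C"
  shows "C \<subseteq> Pol (graph_pairs C n)"
proof -
  have "polymorphism (length xs) (columns k xs) {map g xs | g. (k, g) \<in> C} l f"
    if f: "(l, f) \<in> C" and k: "k \<ge> 1" and xs: "set xs \<subseteq> tuples k" for l f k xs
    unfolding polymorphism_def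
  proof (intro allI impI)
    fix ps assume ps: "length ps = l \<and> set ps \<subseteq> columns k xs"
    then have "\<forall>j\<in>{..<l}. \<exists>i. i < k \<and> ps ! j = map (\<lambda>x. x ! i) xs"
      by (fastforce simp: columns_def dest: nth_mem)
    then obtain \<sigma> where \<sigma>: "\<And>j. j < l \<Longrightarrow> \<sigma> j < k \<and> ps ! j = map (\<lambda>x. x ! \<sigma> j) xs"
      by (metis lessThan_iff)
    have "f (map (\<lambda>p. p ! j) ps) = minor l k \<sigma> f (xs ! j)" if j: "j < length xs" for j
    proof -
      have "map (\<lambda>p. p ! j) ps = map (\<lambda>i. xs ! j ! \<sigma> i) [0..<l]"
        using ps \<sigma> j by (intro nth_equalityI) auto
      moreover have "length (xs ! j) = k" using xs j by (auto dest: nth_mem)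
      ultimately show ?thesis by simp
    qed
    then have "map (\<lambda>j. f (map (\<lambda>p. p ! j) ps)) [0..<length xs] = map (minor l k \<sigma> f) xs"
      by (intro nth_equalityI) auto
    moreover have "(k, minor l k \<sigma> f) \<in> C" using \<sigma> by (intro clonoid_minor[OF C f k]) auto
    ultimately show "map (\<lambda>j. f (map (\<lambda>p. p ! j) ps)) [0..<length xs] \<in> {map g xs | g. (k, g) \<in> C}"
      by auto
  qed
  then show ?thesis
    using clonoid_finitary[OF C] by (fastforce simp: Pol_def graph_pairs_def graph_pair_def)
qed

lemma Pol_graph_pairs_interpolate:
  assumes f: "(k, f) \<in> Pol (graph_pairs C n)"
    and xs: "xs \<noteq> []" "length xs \<le> n" "set xs \<subseteq> tuples k"
  obtains g where "(k, g) \<in> C" "\<And>x. x \<in> set xs \<Longrightarrow> g x = f x"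
proof -
  have k: "k \<ge> 1" using f by (auto simp: Pol_def finitary_functions_iff)
  with xs have "graph_pair C k xs \<in> graph_pairs C n" by (auto simp: graph_pairs_def)
  with f have pol: "polymorphism (length xs) (columns k xs) {map g xs | g. (k, g) \<in> C} k f"
    by (auto simp: Pol_def graph_pair_def)
  \<comment> \<open>All \<open>k\<close> columns in their order: the rows of this matrix are the
    points themselves, so \<open>f\<close> is evaluated at \<open>xs\<close>.\<close>
  let ?ps = "map (\<lambda>i. map (\<lambda>x. x ! i) xs) [0..<k]"
  have "map (\<lambda>j. f (map (\<lambda>p. p ! j) ?ps)) [0..<length xs] \<in> {map g xs | g. (k, g) \<in> C}"
    using pol unfolding polymorphism_def
    by (elim allE[of _ ?ps] mp) (auto simp: columns_def)
  moreover have "map (\<lambda>j. f (map (\<lambda>p. p ! j) ?ps)) [0..<length xs] = map f xs"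
  proof (rule nth_equalityI)
    fix j assume "j < length (map (\<lambda>j. f (map (\<lambda>p. p ! j) ?ps)) [0..<length xs])"
    then have j: "j < length xs" by simp
    then have "length (xs ! j) = k" using xs by (auto dest: nth_mem)
    then have "map (\<lambda>p. p ! j) ?ps = xs ! j" using j by (intro nth_equalityI) auto
    then show "map (\<lambda>j. f (map (\<lambda>p. p ! j) ?ps)) [0..<length xs] ! j = map f xs ! j"
      using j by simp
  qed simp
  ultimately obtain g where "(k, g) \<in> C" "map g xs = map f xs" by auto
  then show thesis using that by (metis map_eq_conv)
qed

text \<open>The value vectors at \<open>xs\<close> form a subalgebra of a power of the target.
  Closure is asked at arity \<open>k\<close> only, because the lemma is applied both to clonoids and
  to the set of term operations.\<close>

lemma polymorphism_values:
  assumes cl: "\<And>n g fs. (n, g) \<in> F \<Longrightarrow> length fs = n \<Longrightarrow> \<forall>f\<in>set fs. (k, f) \<in> C \<Longrightarrow>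
      (k, pointwise k g fs) \<in> C"
    and h: "(l, h) \<in> F" and xs: "set xs \<subseteq> tuples k" and Q: "Q = {map g xs | g. (k, g) \<in> C}"
  shows "polymorphism (length xs) Q Q l h"
  unfolding polymorphism_def
proof (intro allI impI)
  fix qs assume qs: "length qs = l \<and> set qs \<subseteq> Q"
  then have "\<forall>j\<in>{..<l}. \<exists>g. (k, g) \<in> C \<and> qs ! j = map g xs"
    unfolding Q by (fastforce dest: nth_mem)
  then obtain gs where gs: "\<And>j. j < l \<Longrightarrow> (k, gs j) \<in> C \<and> qs ! j = map (gs j) xs"
    by (metis lessThan_iff)
  let ?g = "pointwise k h (map gs [0..<l])"
  have "(k, ?g) \<in> C" using gs by (intro cl[OF h]) auto
  moreover have "map (\<lambda>j. h (map (\<lambda>q. q ! j) qs)) [0..<length xs] = map ?g xs"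
  proof (rule nth_equalityI)
    fix j assume "j < length (map (\<lambda>j. h (map (\<lambda>q. q ! j) qs)) [0..<length xs])"
    then have j: "j < length xs" by simp
    then have "length (xs ! j) = k" using xs by (auto dest: nth_mem)
    moreover have "map (\<lambda>q. q ! j) qs = map (\<lambda>i. gs i (xs ! j)) [0..<l]"
      using gs qs j by (intro nth_equalityI) auto
    ultimately show "map (\<lambda>j. h (map (\<lambda>q. q ! j) qs)) [0..<length xs] ! j = map ?g xs ! j"
      using j by (simp add: o_def)
  qed simp
  ultimately show "map (\<lambda>j. h (map (\<lambda>q. q ! j) qs)) [0..<length xs] \<in> Q" unfolding Q by auto
qed

lemma clonoid_Pol_graph_pairs:
  assumes C: "clonoid F C"
  shows "clonoid F (Pol (graph_pairs C n))"
proof (rule clonoid_Pol)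
  fix m P Q l h assume R: "(m, P, Q) \<in> graph_pairs C n" and h: "(l, h) \<in> F"
  from R obtain k xs where k: "k \<ge> 1" "set xs \<subseteq> tuples k" "m = length xs"
    and Q: "Q = {map g xs | g. (k, g) \<in> C}"
    by (auto simp: graph_pairs_def graph_pair_def)
  show "polymorphism m Q Q l h"
    unfolding k(3) by (rule polymorphism_values[OF clonoid_op[OF C k(1)] h k(2) Q])
qed

subsection \<open>Near-unanimity terms\<close>

text \<open>Induction on the number of points of \<open>S\<close> gives a member of \<open>C\<close>
  that agrees with \<open>f\<close> on \<open>S\<close>. Up to \<open>d\<close> points it comes from
  an invariant pair; beyond that, \<open>d + 1\<close> interpolants that each omit one point are
  combined by \<open>t\<close>.\<close>

lemma Pol_graph_pairs_nu:
  fixes C :: "(nat \<times> ('a::finite list \<Rightarrow> 'b)) set"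
  assumes C: "clonoid F C" and t: "(Suc d, t) \<in> term_ops F" and nu: "nu_operation (Suc d) t"
  shows "Pol (graph_pairs C d) = C"
proof
  show "C \<subseteq> Pol (graph_pairs C d)" by (rule clonoid_subset_Pol_graph_pairs[OF C])
  have d: "d \<ge> 2" using nu by (simp add: nu_operation_def)
  have "(k, f) \<in> C" if f: "(k, f) \<in> Pol (graph_pairs C d)" for k f
  proof -
    have k: "k \<ge> 1" using f by (auto simp: Pol_def finitary_functions_iff)
    have ex: "\<exists>g. (k, g) \<in> C \<and> (\<forall>x\<in>S. g x = f x)" if "S \<subseteq> tuples k" "S \<noteq> {}" for S
      using that
    proof (induction "card S" arbitrary: S rule: less_induct)
      case less
      have fin: "finite S" using less.prems finite_tuples finite_subset finite by metis
      then obtain xs where xs: "set xs = S" "distinct xs" using finite_distinct_list by blast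
      then have len: "length xs = card S" using distinct_card by fastforce
      show ?case
      proof (cases "card S \<le> d")
        case True
        have "xs \<noteq> []" using xs less.prems by auto
        then obtain g where "(k, g) \<in> C" "\<And>x. x \<in> set xs \<Longrightarrow> g x = f x"
          using Pol_graph_pairs_interpolate[OF f, of xs] True len xs less.prems by auto
        with xs show ?thesis by blast
      next
        case False
        have "\<exists>g. (k, g) \<in> C \<and> (\<forall>x\<in>S - {xs ! i}. g x = f x)" if i: "i < Suc d" for i
        proof (rule less.hyps)
          have "xs ! i \<in> S" using xs(1) i False len by force
          then show "card (S - {xs ! i}) < card S" using fin by (rule card_Diff1_less[rotated])
          show "S - {xs ! i} \<noteq> {}"
          proof
            assume "S - {xs ! i} = {}"
            then have "S \<subseteq> {xs ! i}" by blast
            then have "card S \<le> 1" using card_mono[of "{xs ! i}" S] by simp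
            then show False using False d by simp
          qed
        qed (use less.prems in blast)
        then obtain g where g: "\<And>i. i < Suc d \<Longrightarrow> (k, g i) \<in> C"
          "\<And>i x. i < Suc d \<Longrightarrow> x \<in> S \<Longrightarrow> x \<noteq> xs ! i \<Longrightarrow> g i x = f x"
          by (metis DiffI singletonD)
        \<comment> \<open>At each point of \<open>S\<close> at most one of the \<open>d + 1\<close>
          arguments is wrong, since the points \<open>xs ! i\<close> are distinct.\<close>
        let ?h = "pointwise k t (map g [0..<Suc d])"
        have "(k, ?h) \<in> C" using g(1) by (intro clonoid_term_op[OF C t] k) auto
        moreover have "?h x = f x" if x: "x \<in> S" for x
        proof -
          obtain i where i: "i < Suc d" "\<And>j. j < Suc d \<Longrightarrow> xs ! j = x \<Longrightarrow> j = i"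
          proof (cases "\<exists>i<Suc d. xs ! i = x")
            case True
            then obtain i where "i < Suc d" "xs ! i = x" by blast
            with that show thesis using xs(2) len False
              by (metis not_less_eq_eq nth_eq_iff_index_eq order_less_le_trans)
          qed (use that[of 0] in auto)
          have "map (\<lambda>i. g i x) [0..<Suc d] = (replicate (Suc d) (f x))[i := g i x]"
            using g(2)[OF _ x] i
            by (intro nth_equalityI) (auto simp: nth_list_update simp del: upt_Suc replicate_Suc)
          moreover have "length x = k" using x less.prems by auto
          ultimately have "?h x = t ((replicate (Suc d) (f x))[i := g i x])"
            by (simp only: pointwise_apply map_map o_def)
          then show ?thesis using nu i(1) unfolding nu_operation_def by (simp only:)
        qed
        ultimately show ?thesis by blast
      qed
    qed
    have "replicate k undefined \<in> (tuples k :: 'a list set)" by simp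
    then obtain g where g: "(k, g) \<in> C" "\<forall>x\<in>tuples k. g x = f x" using ex[of "tuples k"] by blast
    moreover have "g = f"
      using g f clonoid_finitary[OF C] by (intro finitary_functions_eqI[of k]) (auto simp: Pol_def)
    ultimately show ?thesis by simp
  qed
  then show "Pol (graph_pairs C d) \<subseteq> C" by auto
qed

subsection \<open>Higman's lemma\<close>

definition bad_seq :: "(nat \<Rightarrow> 'c list) \<Rightarrow> bool" where
  "bad_seq f \<longleftrightarrow> (\<forall>i j. i < j \<longrightarrow> \<not> subseq (f i) (f j))"

text \<open>The words are chosen one after the other, each of minimal length such that the finite
  sequence still extends to a bad sequence.\<close>

lemma minimal_bad_seq:
  assumes "bad_seq (f :: nat \<Rightarrow> 'c list)"
  obtains m :: "nat \<Rightarrow> 'c list" where "bad_seq m"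
    "\<And>n g. bad_seq g \<Longrightarrow> (\<And>i. i < n \<Longrightarrow> g i = m i) \<Longrightarrow> length (m n) \<le> length (g n)"
proof -
  define ext where "ext xs g \<longleftrightarrow> bad_seq g \<and> map g [0..<length xs] = xs" for xs and g :: "nat \<Rightarrow> 'c list"
  define next_word where
    "next_word xs = (ARG_MIN length w. \<exists>g. ext (xs @ [w]) g)" for xs :: "'c list list"
  define pre where "pre = rec_nat [] (\<lambda>_ xs. xs @ [next_word xs])"
  have pre: "pre 0 = []" "pre (Suc n) = pre n @ [next_word (pre n)]" for n
    by (simp_all add: pre_def)
  have len: "length (pre n) = n" for n by (induction n) (simp_all add: pre)
  have ext_snoc: "ext (xs @ [g (length xs)]) g" if "ext xs g" for xs g
    using that by (auto simp: ext_def)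
  have min: "(\<exists>g. ext (xs @ [next_word xs]) g) \<and>
      (ext xs h \<longrightarrow> length (next_word xs) \<le> length (h (length xs)))" if g: "ext xs g" for xs g h
  proof
    show "\<exists>g. ext (xs @ [next_word xs]) g"
      unfolding next_word_def
      by (rule arg_min_natI[where P = "\<lambda>w. \<exists>g. ext (xs @ [w]) g" and k = "g (length xs)"])
        (use ext_snoc[OF g] in blast)
    show "ext xs h \<longrightarrow> length (next_word xs) \<le> length (h (length xs))"
      unfolding next_word_def by (auto intro!: arg_min_nat_le dest: ext_snoc)
  qed
  have ex: "\<exists>g. ext (pre n) g" for n
  proof (induction n)
    case 0 show ?case using assms by (auto simp: ext_def pre)
  next
    case (Suc n) then show ?case using min by (auto simp: pre)
  qed
  define m where "m n = next_word (pre n)" for n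
  have pre_m: "pre n = map m [0..<n]" for n by (induction n) (simp_all add: pre m_def)
  have ext_m: "ext (pre n) g \<longleftrightarrow> bad_seq g \<and> (\<forall>i<n. g i = m i)" for n g
    by (auto simp: ext_def pre_m)
  show thesis
  proof (rule that)
    show "bad_seq m" unfolding bad_seq_def
    proof (intro allI impI)
      fix i j :: nat assume ij: "i < j"
      obtain g where "bad_seq g" "\<forall>k<Suc j. g k = m k" using ex[of "Suc j"] ext_m by blast
      with ij show "\<not> subseq (m i) (m j)" by (metis bad_seq_def less_SucI less_Suc_eq)
    qed
  next
    fix n g assume "bad_seq g" "\<And>i. i < n \<Longrightarrow> g i = m i"
    then have "ext (pre n) g" by (simp add: ext_m)
    then show "length (m n) \<le> length (g n)" using min[of "pre n" g g] by (simp add: m_def len)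
  qed
qed

text \<open>Nash-Williams' argument: in a minimal bad sequence infinitely many words share their
  first letter, and removing it from them would give a smaller bad sequence.\<close>

theorem higman:
  fixes f :: "nat \<Rightarrow> 'c::finite list"
  obtains i j where "i < j" "subseq (f i) (f j)"
proof -
  have "\<not> bad_seq f"
  proof
    assume "bad_seq f"
    then obtain m :: "nat \<Rightarrow> 'c list" where bad: "bad_seq m"
      and min: "\<And>n g. bad_seq g \<Longrightarrow> (\<And>i. i < n \<Longrightarrow> g i = m i) \<Longrightarrow> length (m n) \<le> length (g n)"
      by (rule minimal_bad_seq) blast
    have ne: "m i \<noteq> []" for i
      using bad by (metis bad_seq_def list_emb_Nil lessI)
    obtain c where "infinite {i. hd (m i) = c}"
      using pigeonhole_infinite[of "UNIV :: nat set" "\<lambda>i. hd (m i)"] finite[of "range (\<lambda>i. hd (m i))"] by auto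
    then obtain r :: "nat \<Rightarrow> nat" where r: "strict_mono r" "\<And>n. hd (m (r n)) = c"
      using infinite_enumerate by (metis (mono_tags, lifting) mem_Collect_eq)
    have m_r: "m (r n) = c # tl (m (r n))" for n
      using ne[of "r n"] r(2)[of n] by (cases "m (r n)") auto
    \<comment> \<open>The words of \<open>m\<close> before the first chosen one, then the tails of
      the chosen ones. A comparable pair in \<open>g\<close> would give one in \<open>m\<close>, as
      the letter \<open>c\<close> can be put back.\<close>
    define g where "g i = (if i < r 0 then m i else tl (m (r (i - r 0))))" for i
    have "bad_seq g" unfolding bad_seq_def
    proof (intro allI impI notI)
      fix i j assume ij: "i < j" and sub: "subseq (g i) (g j)"
      consider "j < r 0" | "i < r 0" "r 0 \<le> j" | "r 0 \<le> i" by linarith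
      then show False
      proof cases
        case 1 with ij sub bad show False by (simp add: g_def bad_seq_def)
      next
        case 2
        then have "subseq (m i) (m (r (j - r 0)))"
          using sub m_r by (metis g_def leD list_emb_Cons)
        moreover have "i < r (j - r 0)" using 2 strict_mono_less_eq[OF r(1), of 0 "j - r 0"] by simp
        ultimately show False using bad by (simp add: bad_seq_def)
      next
        case 3
        then have "subseq (m (r (i - r 0))) (m (r (j - r 0)))"
          using sub ij m_r[of "i - r 0"] m_r[of "j - r 0"]
          by (metis g_def leD less_imp_le order_trans subseq_Cons2_iff)
        moreover have "r (i - r 0) < r (j - r 0)"
          using 3 ij by (intro strict_monoD[OF r(1)]) simp
        ultimately show False using bad by (simp add: bad_seq_def)
      qed
    qed
    then have "length (m (r 0)) \<le> length (g (r 0))" by (rule min) (simp add: g_def)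
    then show False using ne[of "r 0"] by (cases "m (r 0)") (auto simp: g_def)
  qed
  then show thesis using that by (auto simp: bad_seq_def)
qed

lemma subseq_index:
  assumes "subseq xs ys"
  obtains h where "strict_mono_on {..<length xs} h"
    "\<And>i. i < length xs \<Longrightarrow> h i < length ys \<and> xs ! i = ys ! h i"
proof -
  have "\<exists>h. strict_mono_on {..<length xs} h \<and> (\<forall>i<length xs. h i < length ys \<and> xs ! i = ys ! h i)"
    using assms
  proof (induction rule: list_emb.induct)
    case (list_emb_Nil ys) then show ?case by (auto simp: strict_mono_on_def)
  next
    case (list_emb_Cons xs ys y)
    then obtain h where "strict_mono_on {..<length xs} h"
      "\<forall>i<length xs. h i < length ys \<and> xs ! i = ys ! h i" by auto
    then show ?case
      by (intro exI[of _ "\<lambda>i. Suc (h i)"]) (auto simp: strict_mono_on_def)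
  next
    case (list_emb_Cons2 x y xs ys)
    then obtain h where "strict_mono_on {..<length xs} h"
      "\<forall>i<length xs. h i < length ys \<and> xs ! i = ys ! h i" by auto
    with list_emb_Cons2(1) show ?case
      by (intro exI[of _ "case_nat 0 (\<lambda>i. Suc (h i))"])
        (auto simp: strict_mono_on_def less_Suc_eq_0_disj split: nat.splits)
  qed
  then show thesis using that by blast
qed

subsection \<open>Minority terms: forks and finite relatedness\<close>

text \<open>On two elements the last case has \<open>x = w\<close>, so that this is the sum x + y +
  w over GF(2).\<close>

definition minority :: "'b \<Rightarrow> 'b \<Rightarrow> 'b \<Rightarrow> 'b" where
  "minority x y w = (if x = y then w else if y = w then x else y)"

definition lexless :: "('a \<Rightarrow> nat) \<Rightarrow> 'a list \<Rightarrow> 'a list \<Rightarrow> bool" where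
  "lexless e x y \<longleftrightarrow> (\<exists>i<length y. e (x ! i) < e (y ! i) \<and> (\<forall>j<i. x ! j = y ! j))"

lemma lexless_total:
  assumes "inj e" "length x = length y" "x \<noteq> y"
  shows "lexless e x y \<or> lexless e y x"
proof -
  define i where "i = (LEAST i. x ! i \<noteq> y ! i)"
  obtain i0 where i0: "i0 < length y" "x ! i0 \<noteq> y ! i0" using assms(2,3) by (auto simp: list_eq_iff_nth_eq)
  then have "x ! i \<noteq> y ! i" unfolding i_def by (metis (mono_tags, lifting) LeastI)
  moreover have "x ! j = y ! j" if "j < i" for j using that not_less_Least unfolding i_def by blast
  moreover have "i < length y" unfolding i_def by (rule le_less_trans[OF Least_le i0(1)]) (rule i0(2))
  moreover have "e (x ! i) \<noteq> e (y ! i)" using calculation(1) assms(1) by (simp add: inj_eq)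
  ultimately show ?thesis unfolding lexless_def using assms(2) by (metis linorder_neqE_nat)
qed

lemma lexless_trans:
  assumes "lexless e x y" "lexless e y z" "length y = length z"
  shows "lexless e x z"
proof -
  obtain i where i: "i < length y" "e (x ! i) < e (y ! i)" "\<forall>j<i. x ! j = y ! j"
    using assms(1) by (auto simp: lexless_def)
  obtain i' where i': "i' < length z" "e (y ! i') < e (z ! i')" "\<forall>j<i'. y ! j = z ! j"
    using assms(2) by (auto simp: lexless_def)
  have "e (x ! min i i') < e (z ! min i i')"
    using i i' by (cases i i' rule: linorder_cases) (auto simp: min_def)
  then show ?thesis
    using i i' unfolding lexless_def by (intro exI[of _ "min i i'"]) auto
qed

lemma lexless_irrefl: "\<not> lexless e x x"
  by (simp add: lexless_def)

definition forks :: "('a \<Rightarrow> nat) \<Rightarrow> (nat \<times> ('a list \<Rightarrow> 'b)) set \<Rightarrow> 'a list set" where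
  "forks e C = {w. \<exists>f g. (length w, f) \<in> C \<and> (length w, g) \<in> C \<and> f w \<noteq> g w \<and>
    (\<forall>x. length x = length w \<longrightarrow> lexless e x w \<longrightarrow> f x = g x)}"

text \<open>Gaussian elimination along the lexicographic order: a member of \<open>C\<close> that
  agrees with \<open>f\<close> below a word \<open>a\<close> but not at \<open>a\<close> makes
  \<open>a\<close> a fork of \<open>D\<close>, hence of \<open>C\<close>, and a pair witnessing the
  latter corrects the value at \<open>a\<close>.\<close>

lemma mem_if_forks_subset:
  fixes C D :: "(nat \<times> ('a::finite list \<Rightarrow> 'b)) set"
  assumes two: "CARD('b) = 2" and e: "inj e"
    and C: "clonoid F C" and m: "term3 F (minority :: 'b \<Rightarrow> _)"
    and D: "D \<subseteq> finitary_functions" and CD: "C \<subseteq> D" and forks: "forks e D \<subseteq> forks e C"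
    and c: "(k, c) \<in> C" and f: "(k, f) \<in> D"
  shows "(k, f) \<in> C"
proof -
  have two': "x = y \<or> y = z \<or> x = z" for x y z :: 'b
    using two unfolding card_2_iff by (metis UNIV_I empty_iff insert_iff)
  define r where "r x = card {y \<in> tuples k. lexless e y x}" for x :: "'a list"
  have fin: "finite (tuples k :: 'a list set)" by (simp add: finite_tuples)
  have r: "r x < r y" if "length x = k" "length y = k" "lexless e x y" for x y
    unfolding r_def
  proof (rule psubset_card_mono)
    show "{z \<in> tuples k. lexless e z x} \<subset> {z \<in> tuples k. lexless e z y}"
      using that lexless_irrefl[of e x] by (auto intro: lexless_trans)
    show "finite {z \<in> tuples k. lexless e z y}" by (rule finite_subset[OF _ fin]) auto
  qed
  have "\<exists>g. (k, g) \<in> C \<and> (\<forall>x. length x = k \<longrightarrow> r x < n \<longrightarrow> g x = f x)" for n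
  proof (induction n)
    case 0 then show ?case using c by blast
  next
    case (Suc n)
    then obtain g where g: "(k, g) \<in> C" "\<And>x. length x = k \<Longrightarrow> r x < n \<Longrightarrow> g x = f x" by blast
    show ?case
    proof (cases "\<exists>a. length a = k \<and> r a = n \<and> g a \<noteq> f a")
      case False
      then show ?thesis using g by (metis less_Suc_eq)
    next
      case True
      then obtain a where a: "length a = k" "r a = n" "g a \<noteq> f a" by blast
      have "a \<in> forks e D"
        unfolding forks_def using a f g CD r by (intro CollectI exI[of _ g] exI[of _ f]) auto
      then obtain h h' where h: "(k, h) \<in> C" "(k, h') \<in> C" "h a \<noteq> h' a"
        "\<And>x. length x = k \<Longrightarrow> lexless e x a \<Longrightarrow> h x = h' x"
        using forks a(1) unfolding forks_def by blast
      \<comment> \<open>The sum g + h + h' over GF(2): unchanged below \<open>a\<close>, where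
        \<open>h\<close> and \<open>h'\<close> agree, and flipped at \<open>a\<close>.\<close>
      let ?g = "\<lambda>x\<in>tuples k. minority (g x) (h x) (h' x)"
      have "(k, ?g) \<in> C" by (rule clonoid_term3[OF C m g(1) h(1,2)])
      moreover have "?g x = f x" if x: "length x = k" "r x < Suc n" for x
      proof (cases "x = a")
        case True
        have "minority (g a) (h a) (h' a) = f a"
          using h(3) a(3) two' unfolding minority_def by metis
        then show ?thesis using x True by simp
      next
        case False
        then have l: "lexless e x a" using lexless_total[OF e, of x a] r[of a x] x a by auto
        then have "r x < n" using r[of x a] x a by simp
        then show ?thesis using g(2)[of x] h(4)[OF _ l] x by (auto simp: minority_def)
      qed
      ultimately show ?thesis by blast
    qed
  qed
  from this[of "Suc (card (tuples k :: 'a list set))"]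
  obtain g where g: "(k, g) \<in> C"
    "\<And>x. length x = k \<Longrightarrow> r x < Suc (card (tuples k :: 'a list set)) \<Longrightarrow> g x = f x" by blast
  have "r x < Suc (card (tuples k :: 'a list set))" for x
    unfolding r_def less_Suc_eq_le by (rule card_mono[OF fin]) auto
  then have "g = f"
    using g f D clonoid_finitary[OF C] by (intro finitary_functions_eqI[of k]) auto
  with g show ?thesis by simp
qed

text \<open>
  The first occurrences under \<open>\<sigma>\<close> of the positions of \<open>a\<close> are increasing. So composing with \<open>\<sigma>\<close>
  takes words below \<open>a\<close> to words below \<open>b\<close> in the lexicographic order.
\<close>

definition word_le :: "'a list \<Rightarrow> 'a list \<Rightarrow> bool" where
  "word_le a b \<longleftrightarrow> (\<exists>\<sigma>. (\<forall>j<length b. \<sigma> j < length a \<and> b ! j = a ! \<sigma> j) \<and>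
    (\<forall>i<length a. \<exists>p<length b. \<sigma> p = i \<and> (\<forall>j<p. \<sigma> j < i)))"

lemma forks_downward_closed:
  assumes C: "clonoid F C" and b: "b \<in> forks e C" and le: "word_le a b"
  shows "a \<in> forks e C"
proof -
  obtain f g where fg: "(length b, f) \<in> C" "(length b, g) \<in> C" "f b \<noteq> g b"
    "\<And>x. length x = length b \<Longrightarrow> lexless e x b \<Longrightarrow> f x = g x"
    using b by (auto simp: forks_def)
  obtain \<sigma> where \<sigma>: "\<And>j. j < length b \<Longrightarrow> \<sigma> j < length a \<and> b ! j = a ! \<sigma> j"
    "\<And>i. i < length a \<Longrightarrow> \<exists>p<length b. \<sigma> p = i \<and> (\<forall>j<p. \<sigma> j < i)"
    using le unfolding word_le_def by blast
  have "length b \<ge> 1" by (rule clonoid_arity[OF C fg(1)])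
  then have a: "length a \<ge> 1" using \<sigma>(1)[of 0] by linarith
  let ?m = "minor (length b) (length a) \<sigma>"
  have ba: "map (\<lambda>j. a ! \<sigma> j) [0..<length b] = b" using \<sigma>(1) by (intro nth_equalityI) auto
  have "?m f x = ?m g x" if x: "length x = length a" "lexless e x a" for x
  proof -
    let ?y = "map (\<lambda>j. x ! \<sigma> j) [0..<length b]"
    obtain i where i: "i < length a" "e (x ! i) < e (a ! i)" "\<forall>j<i. x ! j = a ! j"
      using x by (auto simp: lexless_def)
    obtain p where p: "p < length b" "\<sigma> p = i" "\<forall>j<p. \<sigma> j < i" using \<sigma>(2)[OF i(1)] by blast
    \<comment> \<open>All positions before \<open>p\<close> come from positions of \<open>a\<close>
      before \<open>i\<close>, where \<open>x\<close> and \<open>a\<close> agree, so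
      \<open>?y\<close> first differs from \<open>b\<close> at \<open>p\<close>.\<close>
    have "lexless e ?y b"
      unfolding lexless_def using i p \<sigma>(1) by (intro exI[of _ p]) auto
    then have "f ?y = g ?y" by (intro fg(4)) simp_all
    then show ?thesis using x by simp
  qed
  moreover have "(length a, ?m f) \<in> C" "(length a, ?m g) \<in> C"
    using fg(1,2) a \<sigma>(1) by (auto intro: clonoid_minor[OF C])
  moreover have "?m f a \<noteq> ?m g a" using fg(3) ba by simp
  ultimately show ?thesis unfolding forks_def by blast
qed

text \<open>
  A subsequence of marked words keeps all first occurrences of letters, so each omitted letter of
  the larger word occurs earlier among the kept ones.
\<close>

definition mark :: "'a list \<Rightarrow> ('a \<times> bool \<times> 'a set) list" where
  "mark w = map (\<lambda>i. (w ! i, w ! i \<notin> set (take i w), set w)) [0..<length w]"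

lemma word_le_if_subseq_mark:
  assumes sub: "subseq (mark a) (mark b)" and a: "a \<noteq> []"
  shows "word_le a b"
proof -
  obtain h where h: "strict_mono_on {..<length a} h"
    "\<And>i. i < length a \<Longrightarrow> h i < length b \<and> mark a ! i = mark b ! h i"
    using subseq_index[OF sub] by (auto simp: mark_def)
  have hb: "h i < length b" "a ! i = b ! h i"
    "a ! i \<notin> set (take i a) \<longleftrightarrow> b ! h i \<notin> set (take (h i) b)" "set a = set b"
    if "i < length a" for i
    using conjunct1[OF h(2)[OF that]] conjunct2[OF h(2)[OF that]] that
    by (auto simp: mark_def)
  \<comment> \<open>This uses the third component of the marks: every letter of \<open>b\<close>
    occurs in \<open>a\<close>, so the \<open>LEAST\<close> below is attained.\<close>
  have ab: "set a = set b" using hb(4)[of 0] a by simp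
  have mono: "i < j" if "h i < h j" "i < length a" "j < length a" for i j
    using that h(1) by (metis lessThan_iff less_asym linorder_neqE_nat strict_mono_onD)
  \<comment> \<open>Kept positions go back along \<open>h\<close>. An omitted position goes to the
    first occurrence of its letter in \<open>a\<close>, whose image under \<open>h\<close> is a
    first occurrence in \<open>b\<close>.\<close>
  define \<sigma> where "\<sigma> j = (if \<exists>i<length a. h i = j then (THE i. i < length a \<and> h i = j)
    else (LEAST i. a ! i = b ! j))" for j
  have \<sigma>h: "\<sigma> (h i) = i" if i: "i < length a" for i
  proof -
    have "(THE i'. i' < length a \<and> h i' = h i) = i"
      using i strict_mono_on_imp_inj_on[OF h(1)] by (intro the_equality) (auto dest: inj_onD)
    then show ?thesis using i by (auto simp: \<sigma>_def)
  qed
  have \<sigma>L: "\<sigma> j < length a \<and> a ! \<sigma> j = b ! j \<and> h (\<sigma> j) \<le> j" if j: "j < length b" for j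
  proof (cases "\<exists>i<length a. h i = j")
    case True
    then show ?thesis using \<sigma>h hb by auto
  next
    case False
    then have s: "\<sigma> j = (LEAST i. a ! i = b ! j)" unfolding \<sigma>_def by (rule if_not_P)
    have "b ! j \<in> set a" using ab j by simp
    then obtain i where i: "i < length a" "a ! i = b ! j" by (auto simp: in_set_conv_nth)
    have l: "\<sigma> j < length a" unfolding s by (rule le_less_trans[OF Least_le i(1)]) (rule i(2))
    have eq: "a ! \<sigma> j = b ! j" unfolding s by (rule LeastI[of _ i]) (rule i(2))
    have "a ! \<sigma> j \<notin> set (take (\<sigma> j) a)"
    proof
      assume "a ! \<sigma> j \<in> set (take (\<sigma> j) a)"
      then obtain i' where "i' < \<sigma> j" "a ! i' = b ! j" using eq l by (auto simp: in_set_conv_nth)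
      then show False unfolding s using not_less_Least by blast
    qed
    then have nb: "b ! h (\<sigma> j) \<notin> set (take (h (\<sigma> j)) b)" using hb(3)[OF l] by simp
    have "h (\<sigma> j) \<le> j"
    proof (rule ccontr)
      assume "\<not> h (\<sigma> j) \<le> j"
      then have "b ! j \<in> set (take (h (\<sigma> j)) b)" using j by (force simp: in_set_conv_nth)
      with nb show False using hb(2)[OF l] eq by simp
    qed
    with l eq show ?thesis by simp
  qed
  show ?thesis
    unfolding word_le_def
  proof (intro exI[of _ \<sigma>] conjI allI impI)
    fix i assume i: "i < length a"
    have "\<sigma> j < i" if "j < h i" for j
      using that \<sigma>L[of j] mono[of "\<sigma> j" i] i hb(1)[OF i] by simp
    then show "\<exists>p<length b. \<sigma> p = i \<and> (\<forall>j<p. \<sigma> j < i)"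
      using i \<sigma>h hb(1) by (intro exI[of _ "h i"]) simp
  qed (use \<sigma>L in auto)
qed

text \<open>If no approximation \<open>E n\<close> equals \<open>C\<close>, each has a fork that
  \<open>C\<close> lacks. At arities with at most \<open>n\<close> tuples, \<open>E n\<close>
  coincides with \<open>C\<close>. So for indices growing fast enough, Higman's lemma makes an
  earlier fork a fork of a later approximation, hence of \<open>C\<close>.\<close>

lemma Pol_graph_pairs_minority:
  fixes C :: "(nat \<times> ('a::finite list \<Rightarrow> 'b)) set"
  assumes two: "CARD('b) = 2" and C: "clonoid F C" and m: "term3 F (minority :: 'b \<Rightarrow> _)"
  shows "\<exists>n. Pol (graph_pairs C n) = C"
proof (rule ccontr)
  assume "\<nexists>n. Pol (graph_pairs C n) = C"
  define E where "E n = Pol (graph_pairs C n)" for n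
  have E_ne: "E n \<noteq> C" for n using \<open>\<nexists>n. _\<close> by (simp add: E_def)
  have E_C: "C \<subseteq> E n" for n unfolding E_def by (rule clonoid_subset_Pol_graph_pairs[OF C])
  have E_clonoid: "clonoid F (E n)" for n unfolding E_def by (rule clonoid_Pol_graph_pairs[OF C])
  obtain e :: "'a \<Rightarrow> nat" where e: "inj e" using finite_imp_inj_to_nat_seg[OF finite] by blast
  have E_large: "(k, f) \<in> C"
    if f: "(k, f) \<in> E n" and n: "card (tuples k :: 'a list set) \<le> n" for k f n
  proof -
    obtain xs where xs: "set xs = (tuples k :: 'a list set)" "distinct xs"
      using finite_distinct_list[OF finite_tuples[OF finite]] by blast
    have "replicate k undefined \<in> set xs" using xs by simp
    then have "xs \<noteq> []" by auto
    moreover have "length xs \<le> n" using n xs distinct_card by metis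
    ultimately obtain g where g: "(k, g) \<in> C" "\<And>x. x \<in> set xs \<Longrightarrow> g x = f x"
      using Pol_graph_pairs_interpolate[of k f C n xs] f xs unfolding E_def by auto
    have "g = f"
      using g f xs clonoid_finitary[OF C] by (intro finitary_functions_eqI[of k]) (auto simp: E_def Pol_def)
    with g show ?thesis by simp
  qed
  \<comment> \<open>The elimination starts from a member of \<open>C\<close> of the right arity, so
    the empty clonoid is treated apart: its approximation by single points is already empty.\<close>
  have C_ne: "C \<noteq> {}"
  proof
    assume C0: "C = {}"
    have "(k, f) \<notin> E 1" for k f
    proof
      assume "(k, f) \<in> E 1"
      then show False using Pol_graph_pairs_interpolate[of k f C 1 "[replicate k undefined]"] C0
        unfolding E_def by simp
    qed
    then have "E 1 = C" using C0 by auto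
    then show False using E_ne by blast
  qed
  have C_k: "\<exists>c. (k, c) \<in> C" if "k \<ge> 1" for k
    using C_ne clonoid_minor[OF C _ that, of _ _ "\<lambda>_. 0"] that by fastforce
  have "\<exists>w. w \<in> forks e (E n) \<and> w \<notin> forks e C" for n
  proof (rule ccontr)
    assume "\<nexists>w. w \<in> forks e (E n) \<and> w \<notin> forks e C"
    then have sub: "forks e (E n) \<subseteq> forks e C" by blast
    have "(k, f) \<in> C" if f: "(k, f) \<in> E n" for k f
    proof -
      obtain c where "(k, c) \<in> C" using C_k clonoid_arity[OF E_clonoid f] by blast
      then show ?thesis
        using mem_if_forks_subset[OF two e C m clonoid_finitary[OF E_clonoid] E_C sub] f by blast
    qed
    then show False using E_ne E_C by (metis subrelI subset_antisym)
  qed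
  then obtain w where w: "\<And>n. w n \<in> forks e (E n)" "\<And>n. w n \<notin> forks e C" by metis
  \<comment> \<open>\<open>N\<close> grows so fast that \<open>E (N j)\<close> coincides with
    \<open>C\<close> at the arities of all \<open>w (N i)\<close> with \<open>i < j\<close>.\<close>
  define N where "N = rec_nat 0 (\<lambda>_ n. max n (card (tuples (length (w n)) :: 'a list set)))"
  have N_Suc: "N (Suc i) = max (N i) (card (tuples (length (w (N i))) :: 'a list set))" for i
    by (simp add: N_def)
  have N_mono: "N i \<le> N j" if "i \<le> j" for i j
    using that by (rule lift_Suc_mono_le[rotated]) (simp add: N_Suc)
  obtain i j where ij: "i < j" "subseq (mark (w (N i))) (mark (w (N j)))"
    using higman[of "\<lambda>i. mark (w (N i))"] by blast
  have "w (N i) \<noteq> []"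
    using w(1)[of "N i"] clonoid_arity[OF E_clonoid] by (fastforce simp: forks_def)
  then have "word_le (w (N i)) (w (N j))" using ij by (intro word_le_if_subseq_mark)
  then have "w (N i) \<in> forks e (E (N j))" by (rule forks_downward_closed[OF E_clonoid w(1)])
  moreover have "card (tuples (length (w (N i))) :: 'a list set) \<le> N j"
    using N_mono[of "Suc i" j] ij(1) by (simp add: N_Suc)
  ultimately have "w (N i) \<in> forks e C" using E_large unfolding forks_def by blast
  with w(2) show False by blast
qed

subsection \<open>Term operations on a two-element set\<close>

lemma has_majority_termI:
  assumes m: "term3 F m" and nu: "\<And>x y. m x x y = x \<and> m x y x = x \<and> m y x x = x"
  shows "has_majority_term F"
  unfolding has_majority_term_def
proof (intro exI conjI)
  show "(3, \<lambda>xs\<in>tuples 3. m (xs ! 0) (xs ! 1) (xs ! 2)) \<in> term_ops F"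
    using m unfolding term3_def term_fn_def .
  have "i = 0 \<or> i = 1 \<or> i = 2" if "i < 3" for i :: nat using that by auto
  then show "nu_operation 3 (\<lambda>xs\<in>tuples 3. m (xs ! 0) (xs ! 1) (xs ! 2))"
    using nu by (force simp: nu_operation_def numeral_3_eq_3 numeral_2_eq_2)
qed

lemma has_malcev_termI:
  assumes m: "term3 F m" and mal: "\<And>x y. m y y x = x \<and> m x y y = x"
  shows "has_malcev_term F"
  unfolding has_malcev_term_def
proof (intro exI conjI)
  show "(3, \<lambda>xs\<in>tuples 3. m (xs ! 0) (xs ! 1) (xs ! 2)) \<in> term_ops F"
    using m unfolding term3_def term_fn_def .
qed (use mal in \<open>simp add: numeral_3_eq_3 numeral_2_eq_2\<close>)

lemma has_nu_termI:
  assumes t: "term_fn F k t" and k: "k \<ge> 3"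
    and nu: "\<And>x y i. i < k \<Longrightarrow> t ((replicate k x)[i := y]) = x"
  shows "has_nu_term F"
  using assms unfolding has_nu_term_def nu_operation_def term_fn_def
  by (intro bexI[of _ "(k, restrict t (tuples k))"]) auto

lemma has_nu_term_if_majority: "has_majority_term F \<Longrightarrow> has_nu_term F"
  by (auto simp: has_majority_term_def has_nu_term_def)

text \<open>With \<open>z\<close> and \<open>e\<close> as 0 and 1 this is the meet on two elements;
  \<open>meet e z\<close> is then the join.\<close>

definition meet :: "'b \<Rightarrow> 'b \<Rightarrow> 'b \<Rightarrow> 'b \<Rightarrow> 'b" where
  "meet z e x y = (if x = e \<and> y = e then e else z)"

lemma card_2_elements:
  assumes "CARD('b) = 2"
  obtains z e :: 'b where "z \<noteq> e" "\<And>x. x = z \<or> x = e"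
  using assms unfolding card_2_iff by (metis UNIV_I empty_iff insert_iff)

section \<open>From Mal'cev terms to majority or minority terms\<close>

text \<open>The two extra values make \<open>g\<close> the meet, and \<open>f a c b\<close> with
  \<open>c\<close> the meet of \<open>a\<close> and \<open>b\<close> is their join. So
  \<open>j\<close> is xy \<or> xw, and the last term is xy \<or> xw \<or> yw.\<close>

lemma majority_if_malcev_meet:
  assumes B: "z \<noteq> e" "\<And>x :: 'b. x = z \<or> x = e" and f: "term3 F f"
    and mal: "\<And>x y. f y y x = x" "\<And>x y. f x y y = x"
    and meet: "f z e z = z" "f e z e = z"
  shows "has_majority_term F"
proof -
  define g where "g x y = f x y x" for x y
  define j where "j x y w = f (g x y) (g (g x y) w) (g x w)" for x y w
  have g: "term2 F g"
    unfolding term2_def g_def by (intro term_fn_comp3[OF f] term_fn_proj) simp_all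
  have j: "term3 F j"
    unfolding term3_def j_def
    by (intro term_fn_comp3[OF f] term_fn_comp2[OF g] term_fn_proj) simp_all
  have "term3 F (\<lambda>x y w. f (j x y w) (g (g x y) w) (g y w))"
    unfolding term3_def
    by (intro term_fn_comp3[OF f] term_fn_comp3[OF j] term_fn_comp2[OF g] term_fn_proj) simp_all
  then show ?thesis
  proof (rule has_majority_termI)
    fix x y
    show "f (j x x y) (g (g x x) y) (g x y) = x \<and> f (j x y x) (g (g x y) x) (g y x) = x \<and>
        f (j y x x) (g (g y x) x) (g x x) = x"
      using B(2)[of x] B(2)[of y] by (elim disjE) (simp_all add: j_def g_def mal meet)
  qed
qed

text \<open>The Mal'cev identities leave only the values \<open>f z e z\<close> and
  \<open>f e z e\<close> open. They make \<open>f x y x\<close> the meet, the join, \<open>x\<close>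
  or \<open>y\<close>.\<close>

lemma malcev_majority_or_minority:
  assumes two: "CARD('b) = 2" and mal: "has_malcev_term (F :: (nat \<times> ('b list \<Rightarrow> 'b)) set)"
  shows "has_majority_term F \<or> term3 F minority"
proof -
  obtain z e :: 'b where B: "z \<noteq> e" "\<And>x. x = z \<or> x = e" using card_2_elements[OF two] by blast
  obtain f0 where f0: "(3, f0) \<in> term_ops F" "\<And>x y. f0 [y, y, x] = x \<and> f0 [x, y, y] = x"
    using mal unfolding has_malcev_term_def by blast
  define f where "f x y w = f0 [x, y, w]" for x y w
  have f: "term3 F f"
    unfolding term3_def
  proof (rule term_fn_cong[OF term_fn_of_op[OF f0(1)]])
    fix xs :: "'b list" assume "length xs = 3"
    then have "xs = [xs ! 0, xs ! 1, xs ! 2]" by (auto simp: numeral_3_eq_3 length_Suc_conv)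
    then show "f0 xs = f (xs ! 0) (xs ! 1) (xs ! 2)" unfolding f_def by (rule arg_cong)
  qed
  have m: "f y y x = x" "f x y y = x" for x y using f0(2) by (simp_all add: f_def)
  have B': "x = e \<or> x = z" for x using B(2) by blast
  consider "f z e z = z" "f e z e = z" | "f z e z = e" "f e z e = e"
    | "f z e z = z" "f e z e = e" | "f z e z = e" "f e z e = z"
    using B(2) by blast
  then show ?thesis
  proof cases
    case 1 then show ?thesis using majority_if_malcev_meet[OF B f m] by blast
  next
    case 2 then show ?thesis using majority_if_malcev_meet[OF B(1)[symmetric] B' f m] by blast
  next
    case 3
    then have pix: "f x y x = x" for x y using B(2)[of x] B(2)[of y] m by auto
    \<comment> \<open>Here \<open>f\<close> is a Pixley operation, and this is its usual majority
      term.\<close>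
    have "term3 F (\<lambda>x y w. f x (f x y w) w)"
      unfolding term3_def by (intro term_fn_comp3[OF f] term_fn_proj) simp_all
    then show ?thesis by (intro disjI1 has_majority_termI) (auto simp: m pix)
  next
    case 4
    then have "f x y x = y" for x y using B(2)[of x] B(2)[of y] m by auto
    then have "f x y w = minority x y w" for x y w
      using B(2)[of x] B(2)[of y] B(2)[of w] m unfolding minority_def by metis
    then have "f = minority" by blast
    with f show ?thesis by simp
  qed
qed

text \<open>
  Otherwise \<open>g\<close> gives a term operation \<open>h(u,v,s,t)\<close> with \<open>h(0,1,s,t)\<close> of degree 2 in \<open>s\<close> and \<open>t\<close>. Its
  second difference in \<open>s\<close> and \<open>t\<close>, based at \<open>u\<close>, is the idempotent term operation \<open>q\<close>.
\<close>

lemma term_ops_preserve_minority: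
  assumes two: "CARD('b) = 2" and mi: "term3 F (minority :: 'b \<Rightarrow> _)" and nm: "\<not> has_majority_term F"
    and g: "(n, g) \<in> term_ops F"
    and len: "length xs = n" "length ys = n" "length ws = n"
  shows "g (map (\<lambda>i. minority (xs ! i) (ys ! i) (ws ! i)) [0..<n]) = minority (g xs) (g ys) (g ws)"
proof (rule ccontr)
  assume neq: "\<not> ?thesis"
  obtain z e :: 'b where B: "z \<noteq> e" "\<And>x. x = z \<or> x = e" using card_2_elements[OF two] by blast
  have n: "n \<ge> 1" by (rule term_ops_arity[OF g])
  \<comment> \<open>Over GF(2) this is \<open>c\<close>, plus s + u where \<open>xs\<close> and
    \<open>ys\<close> differ, plus t + u where \<open>ws\<close> and \<open>ys\<close> differ. With
    \<open>u = z\<close> and \<open>v = e\<close>, the four choices of \<open>s\<close> and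
    \<open>t\<close> yield \<open>ys\<close>, \<open>xs\<close>, \<open>ws\<close> and their
    pointwise minority.\<close>
  define \<phi> where "\<phi> i u v s t = (let c = (if ys ! i = z then u else v) in
    if xs ! i \<noteq> ys ! i then (if ws ! i \<noteq> ys ! i then minority c s t else minority c s u)
    else (if ws ! i \<noteq> ys ! i then minority c t u else c))" for i and u v s t :: 'b
  define h where "h u v s t = g (map (\<lambda>i. \<phi> i u v s t) [0..<n])" for u v s t
  have h_term: "term_fn F k (\<lambda>xs. h (a xs) (b xs) (c xs) (d xs))"
    if "term_fn F k a" "term_fn F k b" "term_fn F k c" "term_fn F k d" for k a b c d
    unfolding h_def
  proof (rule term_fn_comp[OF term_fn_of_op[OF g] term_fn_arity[OF that(1)]])
    show "term_fn F k (\<lambda>xs. \<phi> i (a xs) (b xs) (c xs) (d xs))" for i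
      using that unfolding \<phi>_def Let_def
      by (cases "ys ! i = z"; cases "xs ! i = ys ! i"; cases "ws ! i = ys ! i")
        (auto intro!: term_fn_comp3[OF mi])
  qed
  define q where "q u v s t =
    minority (minority (h u v s t) (h u v s u) (h u v u t)) (h u v u u) u" for u v s t
  \<comment> \<open>Identifying \<open>v\<close> with \<open>s\<close> keeps the identities of
    \<open>q\<close> and the value \<open>r z e e = e\<close>; only \<open>r e z z\<close> remains
    open.\<close>
  define r where "r x s t = q x s s t" for x s t
  have r: "term3 F r"
    unfolding term3_def r_def q_def
    by (intro term_fn_comp3[OF mi] h_term term_fn_proj) simp_all
  have q_u: "q u v u t = u" "q u v s u = u" for u v s t
    unfolding q_def minority_def
    using B(2)[of u] B(2)[of "h u v u t"] B(2)[of "h u v u u"] B(2)[of "h u v s u"] by auto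
  have "h z e z z = g ys"
  proof -
    have "map (\<lambda>i. \<phi> i z e z z) [0..<n] = ys"
      using len B by (intro nth_equalityI) (auto simp: \<phi>_def minority_def Let_def)
    then show ?thesis by (simp add: h_def)
  qed
  moreover have "h z e e z = g xs"
  proof -
    have "\<phi> i z e e z = xs ! i" for i
      using B(1) B(2)[of "xs ! i"] B(2)[of "ys ! i"] B(2)[of "ws ! i"]
      by (elim disjE) (simp_all add: \<phi>_def minority_def Let_def)
    then have "map (\<lambda>i. \<phi> i z e e z) [0..<n] = xs" using len by (intro nth_equalityI) simp_all
    then show ?thesis by (simp add: h_def)
  qed
  moreover have "h z e z e = g ws"
  proof -
    have "\<phi> i z e z e = ws ! i" for i
      using B(1) B(2)[of "xs ! i"] B(2)[of "ys ! i"] B(2)[of "ws ! i"]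
      by (elim disjE) (simp_all add: \<phi>_def minority_def Let_def)
    then have "map (\<lambda>i. \<phi> i z e z e) [0..<n] = ws" using len by (intro nth_equalityI) simp_all
    then show ?thesis by (simp add: h_def)
  qed
  moreover have "h z e e e = g (map (\<lambda>i. minority (xs ! i) (ys ! i) (ws ! i)) [0..<n])"
  proof -
    have "\<phi> i z e e e = minority (xs ! i) (ys ! i) (ws ! i)" for i
      using B(1) B(2)[of "xs ! i"] B(2)[of "ys ! i"] B(2)[of "ws ! i"]
      by (elim disjE) (simp_all add: \<phi>_def minority_def Let_def)
    then show ?thesis by (simp add: h_def)
  qed
  ultimately have "h z e e e \<noteq> minority (h z e e z) (h z e z z) (h z e z e)" using neq by simp
  then have qe: "q z e e e = e"
    using B(1) B(2)[of "h z e z z"] B(2)[of "h z e z e"] B(2)[of "h z e e z"] B(2)[of "h z e e e"]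
    unfolding q_def minority_def by (elim disjE) simp_all
  have r1: "r x x t = x" "r x s x = x" for x s t by (simp_all add: r_def q_u)
  have "has_majority_term F"
  proof (cases "r e z z = z")
    case True
    have "r y x x = x" for x y
      using B(2)[of x] B(2)[of y] True qe r1 by (auto simp: r_def)
    then show ?thesis using r1 by (intro has_majority_termI[OF r]) simp
  next
    case False
    then have rez: "r e z z = e" using B(2) by blast
    \<comment> \<open>In this case \<open>r x y y\<close> is the join, so \<open>j\<close> is the
      meet, and the term below is xy + yw + xw over GF(2).\<close>
    define j where "j x y = minority x y (r x y y)" for x y
    have j: "term2 F j"
      unfolding term2_def j_def
      by (intro term_fn_comp3[OF mi] term_fn_comp3[OF r] term_fn_proj) simp_all
    have "term3 F (\<lambda>x y w. minority (j x y) (j y w) (j x w))"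
      unfolding term3_def
      by (intro term_fn_comp3[OF mi] term_fn_comp2[OF j] term_fn_proj) simp_all
    moreover have jv: "j z z = z" "j z e = z" "j e z = z" "j e e = e"
      using qe rez r1 B(1) by (simp_all add: j_def minority_def r_def)
    have "minority (j x x) (j x y) (j x y) = x \<and> minority (j x y) (j y x) (j x x) = x \<and>
        minority (j y x) (j x x) (j y x) = x" for x y
      using B(1) B(2)[of x] B(2)[of y] by (elim disjE) (simp_all add: jv minority_def)
    ultimately show ?thesis by (rule has_majority_termI)
  qed
  with nm show False ..
qed

section \<open>Escaping term operations\<close>

definition escapes :: "(nat \<times> ('b list \<Rightarrow> 'b)) set \<Rightarrow> 'b \<Rightarrow> 'b \<Rightarrow> bool" where
  "escapes F z e \<longleftrightarrow> (\<exists>(r, g) \<in> term_ops F. g (replicate r z) = z \<and>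
    (\<forall>i<r. \<exists>\<rho>. length \<rho> = r \<and> g \<rho> = e \<and> \<rho> ! i = z))"

lemma term_fn_Meet:
  assumes m: "term2 F (meet z e)" and J: "finite J" "J \<noteq> {}" "J \<subseteq> {..<k}"
    and B: "\<And>x. x = z \<or> x = e"
  shows "term_fn F k (\<lambda>xs. if \<forall>j\<in>J. xs ! j = e then e else z)"
  using J
proof (induction J rule: finite_ne_induct)
  case (singleton j)
  then have "term_fn F k (\<lambda>xs. xs ! j)" by (intro term_fn_proj) simp
  then show ?case by (rule term_fn_cong) (use B in auto)
next
  case (insert j J)
  then have "term_fn F k (\<lambda>xs. meet z e (xs ! j) (if \<forall>j\<in>J. xs ! j = e then e else z))"
    by (intro term_fn_comp2[OF m] term_fn_proj) simp_all
  then show ?case by (rule term_fn_cong) (auto simp: meet_def)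
qed

text \<open>
  The arity is \<open>2r\<close> rather than \<open>r\<close> so that every meet \<open>M i\<close> involves at least two variables and hence
  vanishes on tuples with a single entry \<open>e\<close>.
\<close>

lemma escapes_nu:
  assumes B: "z \<noteq> e" "\<And>x. x = z \<or> x = e" and m: "term2 F (meet z e)"
    and g: "(r, g) \<in> term_ops F" "g (replicate r z) = z"
    and \<rho>: "\<And>i. i < r \<Longrightarrow> length (\<rho> i) = r \<and> g (\<rho> i) = e \<and> \<rho> i ! i = z"
    and alt: "g (replicate r e) = e \<or> term2 F (\<lambda>x y. if x = e \<and> y = z then e else z)"
  shows "has_nu_term F"
proof -
  have r1: "r \<ge> 1" by (rule term_ops_arity[OF g(1)])
  have "r \<noteq> 1"
  proof
    assume r: "r = 1"
    then have "\<rho> 0 = replicate r z" using \<rho>[of 0] by (intro nth_equalityI) auto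
    then show False using \<rho>[of 0] r g(2) B(1) by simp
  qed
  with r1 have r: "r \<ge> 2" by simp
  define N where "N = 2 * r"
  \<comment> \<open>\<open>J i\<close> is chosen so that at the tuple with \<open>z\<close> in
    position \<open>j\<close> and \<open>e\<close> elsewhere, \<open>M i\<close> takes the value
    \<open>\<rho> (j mod r) ! i\<close>. There \<open>g\<close> of all the \<open>M i\<close> is
    \<open>g (\<rho> (j mod r))\<close>, which is \<open>e\<close>.\<close>
  define J where "J i = {j. j < N \<and> \<rho> (j mod r) ! i = z}" for i
  define M where "M i xs = (if \<forall>j\<in>J i. xs ! j = e then e else z)" for i xs
  define T where "T xs = (if \<forall>j\<in>{..<N}. xs ! j = e then e else z)" for xs
  have iJ: "i \<in> J i" "i + r \<in> J i" if "i < r" for i using that \<rho> by (auto simp: J_def N_def)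
  have M: "term_fn F N (M i)" if "i < r" for i
    unfolding M_def using iJ[OF that] by (intro term_fn_Meet[OF m _ _ _ B(2)]) (auto simp: J_def)
  have T: "term_fn F N T"
    unfolding T_def using r by (intro term_fn_Meet[OF m _ _ _ B(2)]) (auto simp: N_def lessThan_empty_iff)
  have M1: "M i (replicate N e) = e" for i by (auto simp: M_def J_def)
  have M0: "M i ((replicate N z)[j := y]) = z" if i: "i < r" for i j y
  proof -
    have "i \<noteq> j \<or> i + r \<noteq> j" using r by auto
    moreover have "i < N" "i + r < N" using i by (auto simp: N_def)
    ultimately obtain l where "l \<in> J i" "l \<noteq> j" "l < N" using iJ[OF i] by blast
    then show ?thesis using B(1) by (auto simp: M_def nth_list_update intro!: bexI[of _ l])
  qed
  have Me: "M i ((replicate N e)[j := z]) = \<rho> (j mod r) ! i" if j: "j < N" for i j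
    using j B(1) B(2)[of "\<rho> (j mod r) ! i"] by (auto simp: M_def J_def nth_list_update)
  have T1: "T (replicate N e) = e" by (simp add: T_def)
  have Te: "T ((replicate N e)[j := z]) = z" if "j < N" for j
    using that B(1) by (auto simp: T_def nth_list_update)
  have nu: "has_nu_term F"
    if \<phi>: "\<And>i. i < r \<Longrightarrow> term_fn F N (\<phi> i)"
      and v1: "g (map (\<lambda>i. \<phi> i (replicate N e)) [0..<r]) = e"
      and v0: "\<And>i j y. i < r \<Longrightarrow> j < N \<Longrightarrow> \<phi> i ((replicate N z)[j := y]) = z"
      and ve: "\<And>i j. i < r \<Longrightarrow> j < N \<Longrightarrow> \<phi> i ((replicate N e)[j := z]) = \<rho> (j mod r) ! i" for \<phi>
  proof (rule has_nu_termI)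
    show "term_fn F N (\<lambda>xs. g (map (\<lambda>i. \<phi> i xs) [0..<r]))"
      using r \<phi> by (intro term_fn_comp[OF term_fn_of_op[OF g(1)]]) (auto simp: N_def)
    show "N \<ge> 3" using r by (simp add: N_def)
    fix x y j assume j: "j < N"
    consider "x = z" | "x = e" "y = e" | "x = e" "y = z" using B(2) by blast
    then show "g (map (\<lambda>i. \<phi> i ((replicate N x)[j := y])) [0..<r]) = x"
    proof cases
      case 1
      have "map (\<lambda>i. \<phi> i ((replicate N x)[j := y])) [0..<r] = replicate r z"
        using v0 j 1 by (intro nth_equalityI) auto
      then show ?thesis using g(2) 1 by simp
    next
      case 2
      have "(replicate N e)[j := e] = replicate N e" by (metis j list_update_id nth_replicate)
      then show ?thesis using v1 2 by simp
    next
      case 3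
      have rr: "j mod r < r" using r by simp
      then have "map (\<lambda>i. \<phi> i ((replicate N x)[j := y])) [0..<r] = \<rho> (j mod r)"
        using ve j 3 \<rho> by (intro nth_equalityI) auto
      then show ?thesis using \<rho>[OF rr] 3 by simp
    qed
  qed
  from alt show ?thesis
  proof
    assume g1: "g (replicate r e) = e"
    show ?thesis
    proof (rule nu[of M])
      have "map (\<lambda>i. M i (replicate N e)) [0..<r] = replicate r e"
        using M1 by (intro nth_equalityI) auto
      with g1 show "g (map (\<lambda>i. M i (replicate N e)) [0..<r]) = e" by simp
    qed (use M M0 Me in auto)
  next
    assume d: "term2 F (\<lambda>x y. if x = e \<and> y = z then e else z)"
    \<comment> \<open>Now \<open>g (replicate r e)\<close> may be \<open>z\<close>, so the constant
      tuple \<open>e\<close> must be sent to a preimage of \<open>e\<close> too. \<open>T\<close>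
      tells it from the tuples with one entry \<open>z\<close>, and the \<open>\<phi> i\<close> map
      it to \<open>\<rho> 0\<close>.\<close>
    define \<phi> where "\<phi> i xs =
      (if \<rho> 0 ! i = e then M i xs else if M i xs = e \<and> T xs = z then e else z)" for i xs
    show ?thesis
    proof (rule nu[of \<phi>])
      fix i assume i: "i < r"
      show "term_fn F N (\<phi> i)"
      proof (cases "\<rho> 0 ! i = e")
        case True
        show ?thesis by (rule term_fn_cong[OF M[OF i]]) (simp add: \<phi>_def True)
      next
        case False
        show ?thesis
          by (rule term_fn_cong[OF term_fn_comp2[OF d M[OF i] T]]) (simp add: \<phi>_def False)
      qed
    next
      have "\<phi> i (replicate N e) = \<rho> 0 ! i" for i
        using B(1) B(2)[of "\<rho> 0 ! i"] by (elim disjE) (simp_all add: \<phi>_def M1 T1)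
      then have "map (\<lambda>i. \<phi> i (replicate N e)) [0..<r] = \<rho> 0"
        using \<rho>[of 0] r by (intro nth_equalityI) simp_all
      then show "g (map (\<lambda>i. \<phi> i (replicate N e)) [0..<r]) = e" using \<rho>[of 0] r by simp
    next
      fix i j assume "i < r" "j < N"
      then show "\<phi> i ((replicate N e)[j := z]) = \<rho> (j mod r) ! i"
        using B(2)[of "\<rho> (j mod r) ! i"] by (elim disjE) (simp_all add: \<phi>_def Me Te)
    qed (use M0 in \<open>auto simp: \<phi>_def\<close>)
  qed
qed

text \<open>Identifying variables along \<open>\<rho> 0\<close> gives a binary \<open>b\<close> with
  \<open>b z z = z\<close>, \<open>b e e = z\<close> and \<open>b e z = e\<close>. It is either x
  \<and> \<not> y, which yields the meet, or the sum over GF(2), which yields the Mal'cev term x + y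
  + w.\<close>

lemma escapes_not_idempotent:
  assumes B: "z \<noteq> e" "\<And>x. x = z \<or> x = e"
    and g: "(r, g) \<in> term_ops F" "g (replicate r z) = z" "g (replicate r e) = z"
    and \<rho>: "\<And>i. i < r \<Longrightarrow> length (\<rho> i) = r \<and> g (\<rho> i) = e \<and> \<rho> i ! i = z"
  shows "has_nu_term F \<or> has_malcev_term F"
proof -
  have r: "r \<ge> 1" by (rule term_ops_arity[OF g(1)])
  have B3: "(if x = e then e else z) = x" for x using B(2)[of x] by auto
  define b where "b x y = g (map (\<lambda>i. if \<rho> 0 ! i = e then x else y) [0..<r])" for x y
  have b: "term2 F b"
    unfolding term2_def b_def
  proof (rule term_fn_comp[OF term_fn_of_op[OF g(1)]])
    show "term_fn F 2 (\<lambda>xs. if \<rho> 0 ! i = e then xs ! 0 else xs ! 1)" for i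
      by (cases "\<rho> 0 ! i = e") (simp_all add: term_fn_proj)
  qed simp
  have bv: "b z z = z" "b e e = z" using g by (simp_all add: b_def map_replicate_const)
  have "map (\<lambda>i. if \<rho> 0 ! i = e then e else z) [0..<r] = \<rho> 0"
    using \<rho>[of 0] r by (intro nth_equalityI) (simp_all add: B3)
  then have bez: "b e z = e" using \<rho>[of 0] r by (simp add: b_def)
  show ?thesis
  proof (cases "b z e = z")
    case True
    have b_eq: "b = (\<lambda>x y. if x = e \<and> y = z then e else z)"
    proof (intro ext)
      show "b x y = (if x = e \<and> y = z then e else z)" for x y
        using B(1) B(2)[of x] B(2)[of y] bv bez True by (elim disjE) simp_all
    qed
    have "term2 F (\<lambda>x y. b x (b x y))"
      unfolding term2_def by (intro term_fn_comp2[OF b] term_fn_proj) simp_all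
    moreover have "(\<lambda>x y. b x (b x y)) = meet z e"
    proof (intro ext)
      show "b x (b x y) = meet z e x y" for x y
        using B(1) B(2)[of x] B(2)[of y] by (elim disjE) (simp_all add: bv bez True meet_def)
    qed
    ultimately have "term2 F (meet z e)" by simp
    moreover have "term2 F (\<lambda>x y. if x = e \<and> y = z then e else z)" using b by (simp only: b_eq)
    ultimately show ?thesis using escapes_nu[OF B _ g(1,2) \<rho>] by blast
  next
    case False
    then have bze: "b z e = e" using B(2) by blast
    have "term3 F (\<lambda>x y w. b (b x y) w)"
      unfolding term3_def by (intro term_fn_comp2[OF b] term_fn_proj) simp_all
    moreover have "b (b y y) x = x \<and> b (b x y) y = x" for x y
      using B(2)[of x] B(2)[of y] by (elim disjE) (simp_all add: bv bez bze)
    ultimately show ?thesis by (intro disjI2 has_malcev_termI)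
  qed
qed

text \<open>Equal values at complementary tuples would give, on identifying variables along
  \<open>x\<close>, an idempotent binary operation that is symmetric: the meet or the join.\<close>

lemma term_op_self_dual:
  assumes B: "z \<noteq> e" "\<And>x. x = z \<or> x = e"
    and g: "(r, g) \<in> term_ops F" "g (replicate r z) = z" "g (replicate r e) = e"
    and no_meet: "\<not> term2 F (meet z e)" and no_join: "\<not> term2 F (meet e z)"
    and len: "length x = r" "length y = r" and neg: "\<And>i. i < r \<Longrightarrow> x ! i \<noteq> y ! i"
  shows "g x \<noteq> g y"
proof
  assume eq: "g x = g y"
  have B3: "(if x = e then e else z) = x" for x using B(2)[of x] by auto
  define b where "b u v = g (map (\<lambda>i. if x ! i = e then u else v) [0..<r])" for u v
  have b: "term2 F b"
    unfolding term2_def b_def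
  proof (rule term_fn_comp[OF term_fn_of_op[OF g(1)]])
    show "term_fn F 2 (\<lambda>xs. if x ! i = e then xs ! 0 else xs ! 1)" for i
      by (cases "x ! i = e") (simp_all add: term_fn_proj)
  qed simp
  have bv: "b z z = z" "b e e = e" using g by (simp_all add: b_def map_replicate_const)
  have "map (\<lambda>i. if x ! i = e then e else z) [0..<r] = x"
    using len by (intro nth_equalityI) (simp_all add: B3)
  moreover have "map (\<lambda>i. if x ! i = e then z else e) [0..<r] = y"
  proof (rule nth_equalityI)
    fix i assume "i < length (map (\<lambda>i. if x ! i = e then z else e) [0..<r])"
    then show "map (\<lambda>i. if x ! i = e then z else e) [0..<r] ! i = y ! i"
      using neg[of i] B(1) B(2)[of "x ! i"] B(2)[of "y ! i"] by auto
  qed (simp add: len)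
  ultimately have bx: "b e z = g x" "b z e = g x" using eq by (simp_all add: b_def)
  have "b = meet z e" if "g x = z"
  proof (intro ext)
    show "b u v = meet z e u v" for u v
      using B(2)[of u] B(2)[of v] B(1) by (elim disjE) (simp_all add: bv bx that meet_def)
  qed
  moreover have "b = meet e z" if "g x = e"
  proof (intro ext)
    show "b u v = meet e z u v" for u v
      using B(2)[of u] B(2)[of v] B(1) by (elim disjE) (simp_all add: bv bx that meet_def)
  qed
  ultimately show False using b no_meet no_join B(2) by metis
qed

text \<open>
  In the last case all term operations considered are idempotent and self-dual, and a tuple \<open>\<mu>\<close> with
  \<open>g \<mu> = e\<close> and as few entries \<open>e\<close> as possible decides: one such entry leads to a Mal'cev term, more
  lead to a majority term.
\<close>

lemma nu_or_malcev_if_escapes: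
  assumes B: "z \<noteq> e" "\<And>x. x = z \<or> x = e" and ze: "escapes F z e" and ez: "escapes F e z"
  shows "has_nu_term F \<or> has_malcev_term F"
proof -
  have B3: "(if x = e then e else z) = x" for x using B(2)[of x] by auto
  have B': "e \<noteq> z" "\<And>x. x = e \<or> x = z" using B by auto
  obtain r g where g: "(r, g) \<in> term_ops F" "g (replicate r z) = z"
    and "\<forall>i. \<exists>\<rho>. i < r \<longrightarrow> length \<rho> = r \<and> g \<rho> = e \<and> \<rho> ! i = z"
    using ze unfolding escapes_def by blast
  then obtain \<rho> where \<rho>: "\<And>i. i < r \<Longrightarrow> length (\<rho> i) = r \<and> g (\<rho> i) = e \<and> \<rho> i ! i = z" by metis
  obtain s h where h: "(s, h) \<in> term_ops F" "h (replicate s e) = e"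
    and "\<forall>i. \<exists>\<rho>. i < s \<longrightarrow> length \<rho> = s \<and> h \<rho> = z \<and> \<rho> ! i = e"
    using ez unfolding escapes_def by blast
  then obtain \<eta> where \<eta>: "\<And>i. i < s \<Longrightarrow> length (\<eta> i) = s \<and> h (\<eta> i) = z \<and> \<eta> i ! i = e" by metis
  show ?thesis
  proof (cases "g (replicate r e) = z \<or> h (replicate s z) = e")
    case True
    then show ?thesis
      using escapes_not_idempotent[OF B g _ \<rho>] escapes_not_idempotent[OF B' h _ \<eta>] by blast
  next
    case False
    then have g1: "g (replicate r e) = e" and h1: "h (replicate s z) = z" using B(2) by blast+
    show ?thesis
    proof (cases "term2 F (meet z e) \<or> term2 F (meet e z)")
      case True
      then show ?thesis
        using escapes_nu[OF B _ g \<rho> disjI1[OF g1]] escapes_nu[OF B' _ h \<eta> disjI1[OF h1]] by blast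
    next
      case False
      note dual = term_op_self_dual[OF B g g1]
      define W where "W x = card {i. i < r \<and> x ! i = e}" for x
      obtain \<mu> where \<mu>: "length \<mu> = r" "g \<mu> = e"
        and min: "\<And>x. length x = r \<Longrightarrow> g x = e \<Longrightarrow> W \<mu> \<le> W x"
        using ex_has_least_nat[of "\<lambda>x. length x = r \<and> g x = e" "replicate r e" W] g1 by auto
      have "\<exists>i<r. \<mu> ! i = e"
      proof (rule ccontr)
        assume "\<not> (\<exists>i<r. \<mu> ! i = e)"
        then have "\<mu> = replicate r z" using \<mu> B(2) by (intro nth_equalityI) auto
        then show False using \<mu> g B(1) by simp
      qed
      then obtain i where i: "i < r" "\<mu> ! i = e" by blast
      \<comment> \<open>The variables of \<open>g\<close> are grouped into \<open>i\<close> alone,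
        the others where \<open>x\<close> has entry \<open>e\<close>, and the rest.\<close>
      define t where "t x a b c =
        g (map (\<lambda>j. if j = i then a else if x ! j = e then b else c) [0..<r])" for x a b c
      have t: "term_fn F k (\<lambda>xs. t x (a xs) (b xs) (c xs))"
        if "term_fn F k a" "term_fn F k b" "term_fn F k c" for x k a b c
        unfolding t_def
      proof (rule term_fn_comp[OF term_fn_of_op[OF g(1)] term_fn_arity[OF that(1)]])
        show "term_fn F k (\<lambda>xs. if j = i then a xs else if x ! j = e then b xs else c xs)" for j
          using that by (cases "j = i"; cases "x ! j = e") simp_all
      qed
      have t_dual: "t x a b c \<noteq> t x a' b' c'" if "a \<noteq> a'" "b \<noteq> b'" "c \<noteq> c'" for x a b c a' b' c'
        unfolding t_def using that False by (intro dual) auto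
      have t_idem: "t x a a a = a" for x a
      proof -
        have "map (\<lambda>j. if j = i then a else if x ! j = e then a else a) [0..<r] = replicate r a"
          by (intro nth_equalityI) auto
        then show ?thesis using g g1 B(2)[of a] by (auto simp: t_def)
      qed
      show ?thesis
      proof (cases "\<exists>j<r. j \<noteq> i \<and> \<mu> ! j = e")
        case False
        \<comment> \<open>\<open>\<mu>\<close> has its only \<open>e\<close> at \<open>i\<close>,
          whereas \<open>\<rho> i\<close> has \<open>z\<close> there. Apart from idempotence, these
          two tuples and their complements give all values that the Mal'cev identities
          involve.\<close>
        let ?t = "t (\<rho> i)"
        have "\<mu> ! j = z" if "j < r" "j \<noteq> i" for j using False that B(2) by blast
        then have "map (\<lambda>j. if j = i then e else if \<rho> i ! j = e then z else z) [0..<r] = \<mu>"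
          using i \<mu> by (intro nth_equalityI) auto
        then have t1: "?t e z z = e" using \<mu> by (simp add: t_def)
        have "map (\<lambda>j. if j = i then z else if \<rho> i ! j = e then e else z) [0..<r] = \<rho> i"
          using i \<rho>[OF i(1)] by (intro nth_equalityI) (simp_all add: B3)
        then have t2: "?t z e z = e" using \<rho>[OF i(1)] by (simp add: t_def)
        have t3: "?t z e e = z" using t1 t_dual[of e z z e z e "\<rho> i"] B by metis
        have t4: "?t e z e = z" using t2 t_dual[of z e e z z e "\<rho> i"] B by metis
        have "term3 F (\<lambda>x y w. ?t x w y)"
          unfolding term3_def by (intro t term_fn_proj) simp_all
        moreover have "?t y x y = x \<and> ?t x y y = x" for x y
          using B(2)[of x] B(2)[of y] t1 t2 t3 t4 t_idem by (elim disjE) simp_all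
        ultimately show ?thesis by (intro disjI2 has_malcev_termI)
      next
        case True
        then obtain i' where i': "i' < r" "i' \<noteq> i" "\<mu> ! i' = e" by blast
        let ?t = "t \<mu>"
        have "map (\<lambda>j. if j = i then e else if \<mu> ! j = e then e else z) [0..<r] = \<mu>"
          using i \<mu> by (intro nth_equalityI) (simp_all add: B3)
        then have t1: "?t e e z = e" using \<mu> by (simp add: t_def)
        \<comment> \<open>Minimality of \<open>W \<mu>\<close> applies, since \<open>x\<close> loses
          the entry \<open>e\<close> at \<open>l\<close> and gains none.\<close>
        have small: "g (map x [0..<r]) = z"
          if sub: "\<And>j. x j = e \<Longrightarrow> \<mu> ! j = e" and l: "l < r" "\<mu> ! l = e" "x l \<noteq> e" for x l
        proof (rule ccontr)
          assume "g (map x [0..<r]) \<noteq> z"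
          then have "W \<mu> \<le> W (map x [0..<r])" using B(2) by (intro min) auto
          moreover have "W (map x [0..<r]) < W \<mu>"
            unfolding W_def
          proof (rule psubset_card_mono)
            have "l \<notin> {j. j < r \<and> map x [0..<r] ! j = e}" "l \<in> {j. j < r \<and> \<mu> ! j = e}"
              using l by simp_all
            moreover have "{j. j < r \<and> map x [0..<r] ! j = e} \<subseteq> {j. j < r \<and> \<mu> ! j = e}"
              using sub by auto
            ultimately show "{j. j < r \<and> map x [0..<r] ! j = e} \<subset> {j. j < r \<and> \<mu> ! j = e}"
              by blast
          qed simp
          ultimately show False by simp
        qed
        have t2: "?t e z z = z"
          unfolding t_def using i i' B(1) by (intro small[of _ i']) (simp_all split: if_splits)
        have t3: "?t z e z = z"
          unfolding t_def using i B(1) by (intro small[of _ i]) (simp_all split: if_splits)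
        have t4: "?t z z e = z" using t1 t_dual[of e z e z z e \<mu>] B by metis
        have t5: "?t z e e = e" using t2 t_dual[of e z z e z e \<mu>] B by metis
        have t6: "?t e z e = e" using t3 t_dual[of z e e z z e \<mu>] B by metis
        have "term3 F ?t"
          unfolding term3_def by (intro t term_fn_proj) simp_all
        moreover have "?t x x y = x \<and> ?t x y x = x \<and> ?t y x x = x" for x y
          using B(2)[of x] B(2)[of y] t1 t2 t3 t4 t5 t6 t_idem by (elim disjE) simp_all
        ultimately show ?thesis by (intro disjI1 has_nu_term_if_majority has_majority_termI)
      qed
    qed
  qed
qed

subsection \<open>Infinitely many and continuum many clonoids\<close>

lemma term_fn_basic:
  assumes "(n, g) \<in> F" "n \<ge> 1"
  shows "term_fn F n g"
proof -
  let ?ps = "map (\<lambda>i. \<lambda>xs\<in>tuples n. xs ! i) [0..<n]"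
  have "(n, pointwise n g ?ps) \<in> term_ops F"
    using assms by (intro term_ops.comp) (auto intro: term_ops.proj simp del: restrict_apply)
  then have "term_fn F n (pointwise n g ?ps)" by (rule term_fn_of_op)
  then show ?thesis
  proof (rule term_fn_cong)
    fix xs :: "'a list" assume xs: "length xs = n"
    then have "map (\<lambda>f. f xs) ?ps = xs" by (intro nth_equalityI) auto
    with xs show "pointwise n g ?ps xs = g xs" by simp
  qed
qed

section \<open>Affine operations and functions of bounded degree\<close>

lemma card_filter_insert:
  assumes "finite X" "x \<notin> X"
  shows "card {y \<in> insert x X. P y} = card {y \<in> X. P y} + (if P x then 1 else 0)"
proof (cases "P x")
  case True
  then have "{y \<in> insert x X. P y} = insert x {y \<in> X. P y}" by auto
  then show ?thesis using assms True by simp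
next
  case False
  then have "{y \<in> insert x X. P y} = {y \<in> X. P y}" by auto
  then show ?thesis using False by simp
qed

text \<open>
  With \<open>z\<close> and \<open>e\<close> read as 0 and 1 of GF(2), a function preserving the minority is affine, so it
  commutes with sums up to multiples of its value at 0.
\<close>

lemma affine_sum:
  fixes z e :: 'b
  assumes B: "z \<noteq> e" "\<And>x. x = z \<or> x = e"
    and g: "\<And>xs ys ws. length xs = n \<Longrightarrow> length ys = n \<Longrightarrow> length ws = n \<Longrightarrow>
      g (map (\<lambda>i. minority (xs ! i) (ys ! i) (ws ! i)) [0..<n]) = minority (g xs) (g ys) (g ws)"
    and X: "finite X" and v: "\<And>x. x \<in> X \<Longrightarrow> length (v x) = n" and q: "length q = n"
    and sum: "\<And>i. i < n \<Longrightarrow> q ! i = e \<longleftrightarrow> odd (card {x \<in> X. v x ! i = e})"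
  shows "g q = e \<longleftrightarrow> (odd (card {x \<in> X. g (v x) = e}) \<noteq> (even (card X) \<and> g (replicate n z) = e))"
  using X v q sum
proof (induction X arbitrary: q rule: finite_induct)
  case empty
  then have "q ! i = z" if "i < n" for i using B(2)[of "q ! i"] that by auto
  then have "q = replicate n z" using empty.prems(2) by (intro nth_equalityI) auto
  then show ?case by simp
next
  case (insert x X)
  define q' where "q' = map (\<lambda>i. if odd (card {x \<in> X. v x ! i = e}) then e else z) [0..<n]"
  have IH: "g q' = e \<longleftrightarrow> (odd (card {x \<in> X. g (v x) = e}) \<noteq> (even (card X) \<and> g (replicate n z) = e))"
    by (rule insert.IH) (use insert.prems B(1) in \<open>auto simp: q'_def\<close>)
  have "q ! i = minority (v x ! i) (q' ! i) (replicate n z ! i)" if i: "i < n" for i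
  proof -
    have s: "q ! i = e \<longleftrightarrow> odd (card {y \<in> X. v y ! i = e} + (if v x ! i = e then 1 else 0))"
      using insert.prems(3)[OF i] card_filter_insert[OF insert.hyps, of "\<lambda>y. v y ! i = e"] by simp
    have q': "q' ! i = (if odd (card {x \<in> X. v x ! i = e}) then e else z)" using i by (simp add: q'_def)
    show ?thesis
      using s B(1) B(2)[of "q ! i"] B(2)[of "v x ! i"] i unfolding q' minority_def
      by (cases "odd (card {x \<in> X. v x ! i = e})"; elim disjE) simp_all
  qed
  then have "q = map (\<lambda>i. minority (v x ! i) (q' ! i) (replicate n z ! i)) [0..<n]"
    using insert.prems(2) by (intro nth_equalityI) auto
  also have "g \<dots> = minority (g (v x)) (g q') (g (replicate n z))"
    by (rule g) (use insert.prems in \<open>auto simp: q'_def\<close>)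
  finally have gq: "g q = minority (g (v x)) (g q') (g (replicate n z))" .
  have c: "card {y \<in> insert x X. g (v y) = e} = card {y \<in> X. g (v y) = e} + (if g (v x) = e then 1 else 0)"
    by (rule card_filter_insert[OF insert.hyps])
  have minority_eq: "minority a b c = e \<longleftrightarrow> ((a = e) \<noteq> ((b = e) \<noteq> (c = e)))" for a b c
    using B(1) B(2)[of a] B(2)[of b] B(2)[of c] by (elim disjE) (simp_all add: minority_def)
  have cX: "card (insert x X) = Suc (card X)" using insert.hyps by simp
  show ?case
    unfolding gq c cX minority_eq IH
    by (cases "g (v x) = e"; cases "g (replicate n z) = e"; cases "even (card X)") simp_all
qed

text \<open>
  For \<open>T \<subseteq> {..d}\<close>, the tuple with entries \<open>a\<^sub>1\<close> where \<open>\<phi> i \<in> T\<close> and \<open>a\<^sub>0\<close> elsewhere runs through the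
  vertices of a cube of dimension \<open>d + 1\<close>. So these are the functions of degree at most \<open>d\<close> on
  \<open>{a\<^sub>0, a\<^sub>1}\<close>.
\<close>

definition degree_le :: "'a \<Rightarrow> 'a \<Rightarrow> 'b \<Rightarrow> nat \<Rightarrow> (nat \<times> ('a list \<Rightarrow> 'b)) set" where
  "degree_le a0 a1 e d = {(k, f) \<in> finitary_functions. \<forall>\<phi> \<in> {..<k} \<rightarrow> {..d}.
     even (card {T \<in> Pow {..d}. f (map (\<lambda>i. if \<phi> i \<in> T then a1 else a0) [0..<k]) = e})}"

text \<open>On each cube the value vectors of the arguments sum to 0, and by
  \<open>affine_sum\<close> so do the values of an affine operation: its constant term is counted
  once per vertex, and the number 2^(d+1) of vertices is even.\<close>

lemma clonoid_degree_le:
  fixes z e :: 'b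
  assumes B: "z \<noteq> e" "\<And>x. x = z \<or> x = e"
    and pres: "\<And>n g xs ys ws. (n, g) \<in> F \<Longrightarrow> length xs = n \<Longrightarrow> length ys = n \<Longrightarrow> length ws = n \<Longrightarrow>
      g (map (\<lambda>i. minority (xs ! i) (ys ! i) (ws ! i)) [0..<n]) = minority (g xs) (g ys) (g ws)"
  shows "clonoid F (degree_le a0 a1 e d)"
proof (rule clonoidI)
  show "degree_le a0 a1 e d \<subseteq> finitary_functions" by (auto simp: degree_le_def)
next
  fix k f l \<sigma>
  assume f: "(k, f) \<in> degree_le a0 a1 e d" and l: "1 \<le> (l :: nat)" and \<sigma>: "\<And>i. i < k \<Longrightarrow> \<sigma> i < l"
  have "even (card {T \<in> Pow {..d}. minor k l \<sigma> f (map (\<lambda>i. if \<phi> i \<in> T then a1 else a0) [0..<l]) = e})"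
    if \<phi>: "\<phi> \<in> {..<l} \<rightarrow> {..d}" for \<phi>
  proof -
    have "minor k l \<sigma> f (map (\<lambda>i. if \<phi> i \<in> T then a1 else a0) [0..<l])
        = f (map (\<lambda>i. if \<phi> (\<sigma> i) \<in> T then a1 else a0) [0..<k])" for T
      using \<sigma> by (auto intro!: arg_cong[where f = f])
    moreover have "(\<lambda>i. \<phi> (\<sigma> i)) \<in> {..<k} \<rightarrow> {..d}" using \<phi> \<sigma> by auto
    ultimately show ?thesis using f unfolding degree_le_def by simp
  qed
  then show "(l, minor k l \<sigma> f) \<in> degree_le a0 a1 e d"
    using l by (simp add: degree_le_def minor_in_finitary_functions)
next
  fix k n g and fs :: "('a list \<Rightarrow> 'b) list"
  assume k: "1 \<le> k" and g: "(n, g) \<in> F" and n: "length fs = n"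
    and fs: "\<And>f. f \<in> set fs \<Longrightarrow> (k, f) \<in> degree_le a0 a1 e d"
  have "even (card {T \<in> Pow {..d}. pointwise k g fs (map (\<lambda>i. if \<phi> i \<in> T then a1 else a0) [0..<k]) = e})"
    if \<phi>: "\<phi> \<in> {..<k} \<rightarrow> {..d}" for \<phi>
  proof -
    define r where "r T = map (\<lambda>i. if \<phi> i \<in> T then a1 else a0) [0..<k]" for T
    define v where "v T = map (\<lambda>f. f (r T)) fs" for T
    have "even (card {T \<in> Pow {..d}. v T ! i = e})" if i: "i < n" for i
      using fs[of "fs ! i"] i n \<phi> by (auto simp: degree_le_def v_def r_def)
    then have "g (replicate n z) = e \<longleftrightarrow> (odd (card {T \<in> Pow {..d}. g (v T) = e})
        \<noteq> (even (card (Pow {..d})) \<and> g (replicate n z) = e))"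
      using B n by (intro affine_sum[OF B pres[OF g]]) (auto simp: v_def)
    moreover have "even (card (Pow {..d}))" by (simp add: card_Pow)
    moreover have "pointwise k g fs (r T) = g (v T)" for T by (simp add: r_def v_def)
    ultimately show ?thesis unfolding r_def by auto
  qed
  then show "(k, pointwise k g fs) \<in> degree_le a0 a1 e d"
    using k by (simp add: degree_le_def pointwise_in_finitary_functions del: pointwise_apply)
qed

text \<open>With \<open>a0\<close> and \<open>a1\<close> as 0 and 1, the function is on {0, 1} the
  product of its \<open>k\<close> variables, a monomial of degree \<open>k\<close>.\<close>

lemma conjunction_degree_le_iff:
  fixes z e :: 'b
  assumes ze: "z \<noteq> e" and a: "a0 \<noteq> a1" and k: "k \<ge> 1" "k \<le> Suc d"
  shows "(k, \<lambda>xs\<in>tuples k. if xs = replicate k a1 then e else z) \<in> degree_le a0 a1 e d \<longleftrightarrow> k \<le> d"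
    (is "(k, ?f) \<in> _ \<longleftrightarrow> _")
proof -
  have eq: "?f (map (\<lambda>i. if \<phi> i \<in> T then a1 else a0) [0..<k]) = e \<longleftrightarrow> (\<forall>i<k. \<phi> i \<in> T)" for \<phi> T
  proof -
    have "map (\<lambda>i. if \<phi> i \<in> T then a1 else a0) [0..<k] = replicate k a1 \<longleftrightarrow> (\<forall>i<k. \<phi> i \<in> T)"
      using a by (auto simp: list_eq_iff_nth_eq)
    then show ?thesis using ze by simp
  qed
  have mem: "(k, ?f) \<in> degree_le a0 a1 e d \<longleftrightarrow>
      (\<forall>\<phi>\<in>{..<k} \<rightarrow> {..d}. even (card {T \<in> Pow {..d}. \<forall>i<k. \<phi> i \<in> T}))"
    unfolding degree_le_def
    using k(1) restrict_in_finitary_functions[of k "\<lambda>xs. if xs = replicate k a1 then e else z"]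
    by (simp add: eq del: restrict_apply)
  show ?thesis
  proof
    assume "k \<le> d"
    have "even (card {T \<in> Pow {..d}. \<forall>i<k. \<phi> i \<in> T})" if \<phi>: "\<phi> \<in> {..<k} \<rightarrow> {..d}" for \<phi>
    proof -
      have "card (\<phi> ` {..<k}) < card {..d}"
        using card_image_le[of "{..<k}" \<phi>] \<open>k \<le> d\<close> by simp
      \<comment> \<open>The direction \<open>t\<close> is not in the image of \<open>\<phi>\<close>,
        so the vertices where all factors are 1 come in pairs \<open>T\<close>,
        \<open>insert t T\<close>.\<close>
      then obtain t where t: "t \<in> {..d}" "t \<notin> \<phi> ` {..<k}"
        by (metis card_mono finite_imageI finite_lessThan not_le subsetI)
      define S where "S = {T \<in> Pow ({..d} - {t}). \<forall>i<k. \<phi> i \<in> T}"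
      have "{T \<in> Pow {..d}. \<forall>i<k. \<phi> i \<in> T} = S \<union> insert t ` S"
      proof (intro subset_antisym subsetI)
        fix T assume T: "T \<in> {T \<in> Pow {..d}. \<forall>i<k. \<phi> i \<in> T}"
        show "T \<in> S \<union> insert t ` S"
        proof (cases "t \<in> T")
          case True
          have "T - {t} \<in> S" using T t by (auto simp: S_def)
          moreover have "T = insert t (T - {t})" using True by blast
          ultimately show ?thesis by blast
        next
          case False
          then show ?thesis using T by (auto simp: S_def)
        qed
      qed (use t in \<open>auto simp: S_def\<close>)
      moreover have "finite S" unfolding S_def by simp
      moreover have "inj_on (insert t) S" by (auto simp: S_def inj_on_def)
      moreover have "S \<inter> insert t ` S = {}" by (auto simp: S_def)
      ultimately show ?thesis by (simp add: card_Un_disjoint card_image)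
    qed
    then show "(k, ?f) \<in> degree_le a0 a1 e d" using mem by blast
  next
    assume "(k, ?f) \<in> degree_le a0 a1 e d"
    show "k \<le> d"
    proof (rule ccontr)
      assume "\<not> k \<le> d"
      then have kd: "k = Suc d" using k by simp
      have "{T \<in> Pow {..d}. \<forall>i<k. id i \<in> T} = {{..d}}" by (auto simp: kd)
      moreover have "id \<in> {..<k} \<rightarrow> {..d}" by (auto simp: kd)
      then have "even (card {T \<in> Pow {..d}. \<forall>i<k. id i \<in> T})"
        using mem \<open>(k, ?f) \<in> _\<close> by blast
      ultimately show False by simp
    qed
  qed
qed

lemma infinite_clonoids_if_preserve_minority:
  fixes z e :: 'b and a0 a1 :: 'a
  assumes B: "z \<noteq> e" "\<And>x. x = z \<or> x = e" and a: "a0 \<noteq> a1"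
    and pres: "\<And>n g xs ys ws. (n, g) \<in> F \<Longrightarrow> length xs = n \<Longrightarrow> length ys = n \<Longrightarrow> length ws = n \<Longrightarrow>
      g (map (\<lambda>i. minority (xs ! i) (ys ! i) (ws ! i)) [0..<n]) = minority (g xs) (g ys) (g ws)"
  shows "infinite (clonoids F :: (nat \<times> ('a list \<Rightarrow> 'b)) set set)"
proof -
  have "inj (degree_le a0 a1 e)"
  proof (rule linorder_injI)
    fix c d :: nat assume "c < d"
    then show "degree_le a0 a1 e c \<noteq> degree_le a0 a1 e d"
      using conjunction_degree_le_iff[OF B(1) a, of "Suc c" c]
        conjunction_degree_le_iff[OF B(1) a, of "Suc c" d] by auto
  qed
  then have "infinite (range (degree_le a0 a1 e))" by (rule range_inj_infinite)
  moreover have "clonoid F (degree_le a0 a1 e d)" for d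
    by (rule clonoid_degree_le[OF B]) (rule pres)
  then have "range (degree_le a0 a1 e) \<subseteq> clonoids F" by (auto simp: clonoids_def)
  ultimately show ?thesis by (rule infinite_super[rotated])
qed

section \<open>At most and at least continuum many clonoids\<close>

lemma countable_finitary_functions:
  assumes "finite (UNIV :: 'b set)"
  shows "countable (finitary_functions :: (nat \<times> ('a::finite list \<Rightarrow> 'b)) set)"
  unfolding finitary_functions_def
proof (rule countable_SIGMA)
  show "countable (tuples k \<rightarrow>\<^sub>E UNIV :: ('a list \<Rightarrow> 'b) set)" for k
    using assms by (intro countable_finite finite_PiE finite_tuples) auto
qed simp

lemma clonoids_lepoll_reals:
  assumes "finite (UNIV :: 'b set)"
  shows "(clonoids F :: (nat \<times> ('a::finite list \<Rightarrow> 'b)) set set) \<lesssim> (UNIV :: real set)"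
proof -
  obtain i :: "nat \<times> ('a list \<Rightarrow> 'b) \<Rightarrow> nat" where i: "inj_on i finitary_functions"
    using countable_finitary_functions[OF assms] by (auto simp: countable_def)
  have "inj_on ((`) i) (clonoids F)"
    using inj_on_image_Pow[OF i] by (rule inj_on_subset) (auto simp: clonoids_def dest: clonoid_finitary)
  then have "(clonoids F :: (nat \<times> ('a list \<Rightarrow> 'b)) set set) \<lesssim> (UNIV :: nat set set)"
    unfolding lepoll_def by blast
  then show ?thesis using nat_sets_eqpoll_reals by (rule lepoll_trans2)
qed

text \<open>
  The point \<open>unit n i\<close> has \<open>a\<^sub>1\<close> in position \<open>i\<close> only. Columns that are unit vectors can form only
  rows that are unit vectors if there are as many rows as columns: this makes the functions
  \<open>unit_ind\<close> independent.
\<close>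

definition unit :: "'a \<Rightarrow> 'a \<Rightarrow> nat \<Rightarrow> nat \<Rightarrow> 'a list" where
  "unit a0 a1 n i = (replicate n a0)[i := a1]"

lemma length_unit [simp]: "length (unit a0 a1 n i) = n"
  by (simp add: unit_def)

definition unit_ind :: "'a \<Rightarrow> 'a \<Rightarrow> 'b \<Rightarrow> 'b \<Rightarrow> nat \<Rightarrow> 'a list \<Rightarrow> 'b" where
  "unit_ind a0 a1 z e n = (\<lambda>xs\<in>tuples n. if \<exists>i<n. xs = unit a0 a1 n i then e else z)"

text \<open>The tuples \<open>ps\<close> form a matrix with unit vectors as columns above a constant
  last row, which gives the final \<open>z\<close>. Values \<open>e\<close> in all other rows would
  make these rows unit vectors, and the matrix a permutation matrix with
  \<open>m = n\<close>.\<close>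

lemma polymorphism_unit_ind:
  assumes a: "a0 \<noteq> a1" and B: "z \<noteq> e" "\<And>x. x = z \<or> x = e" and mn: "m \<noteq> n" and m: "m \<ge> 1"
    and Q: "\<And>y. length y = n \<Longrightarrow> y \<noteq> replicate n e \<Longrightarrow> y @ [z] \<in> Q"
  shows "polymorphism (Suc n) {unit a0 a1 n i @ [a0] | i. i < n} Q m (unit_ind a0 a1 z e m)"
  unfolding polymorphism_def
proof (intro allI impI)
  fix ps assume ps: "length ps = m \<and> set ps \<subseteq> {unit a0 a1 n i @ [a0] | i. i < n}"
  then have "\<forall>i\<in>{..<m}. \<exists>c<n. ps ! i = unit a0 a1 n c @ [a0]" by (fastforce dest: nth_mem)
  then obtain c where c: "\<And>i. i < m \<Longrightarrow> c i < n \<and> ps ! i = unit a0 a1 n (c i) @ [a0]"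
    by (metis lessThan_iff)
  let ?f = "unit_ind a0 a1 z e m"
  define y where "y = map (\<lambda>j. ?f (map (\<lambda>p. p ! j) ps)) [0..<n]"
  have row: "map (\<lambda>p. p ! j) ps = map (\<lambda>i. if c i = j then a1 else a0) [0..<m]" if "j < n" for j
    using ps c that by (intro nth_equalityI) (auto simp: unit_def nth_append nth_list_update)
  have "map (\<lambda>p. p ! n) ps = replicate m a0"
    using ps c by (intro nth_equalityI) (auto simp: unit_def nth_append)
  moreover have "replicate m a0 \<noteq> unit a0 a1 m i" if "i < m" for i
    using that a by (auto simp: unit_def list_eq_iff_nth_eq)
  ultimately have "?f (map (\<lambda>p. p ! n) ps) = z" by (auto simp: unit_ind_def)
  then have res: "map (\<lambda>j. ?f (map (\<lambda>p. p ! j) ps)) [0..<Suc n] = y @ [z]" by (simp add: y_def)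
  have "y \<noteq> replicate n e"
  proof
    assume y: "y = replicate n e"
    have ex1: "\<exists>!i. i < m \<and> c i = j" if j: "j < n" for j
    proof -
      have "?f (map (\<lambda>p. p ! j) ps) = e" using j y by (auto simp: y_def list_eq_iff_nth_eq)
      then have "?f (map (\<lambda>i. if c i = j then a1 else a0) [0..<m]) = e" by (simp only: row[OF j])
      then obtain i where i: "i < m" "map (\<lambda>i. if c i = j then a1 else a0) [0..<m] = unit a0 a1 m i"
        using B(1) by (auto simp: unit_ind_def split: if_splits)
      have "c i' = j \<longleftrightarrow> i' = i" if "i' < m" for i'
      proof -
        have "(if c i' = j then a1 else a0) = unit a0 a1 m i ! i'"
          using that by (simp add: i(2)[symmetric])
        also have "\<dots> = (if i' = i then a1 else a0)"
          using that by (simp add: unit_def nth_list_update)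
        finally show ?thesis using a by (auto split: if_splits)
      qed
      then show ?thesis using i(1) by auto
    qed
    have "inj_on c {..<m}" using ex1 c by (intro inj_onI) (metis lessThan_iff)
    moreover have "c ` {..<m} = {..<n}"
    proof
      show "{..<n} \<subseteq> c ` {..<m}" using ex1 by (metis image_eqI lessThan_iff subsetI)
    qed (use c in auto)
    ultimately have "bij_betw c {..<m} {..<n}" by (simp add: bij_betw_def)
    then have "m = n" using bij_betw_same_card by fastforce
    with mn show False ..
  qed
  then show "map (\<lambda>j. ?f (map (\<lambda>p. p ! j) ps)) [0..<Suc n] \<in> Q"
    unfolding res by (intro Q) (simp_all add: y_def)
qed

text \<open>Taking every column once gives the identity matrix above a constant row, hence
  \<open>e\<close> in the first \<open>n\<close> places and \<open>z\<close> in the last.\<close>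

lemma not_polymorphism_unit_ind:
  assumes a: "a0 \<noteq> a1" and Q: "replicate n e @ [z] \<notin> Q"
  shows "\<not> polymorphism (Suc n) {unit a0 a1 n i @ [a0] | i. i < n} Q n (unit_ind a0 a1 z e n)"
proof
  let ?f = "unit_ind a0 a1 z e n" and ?ps = "map (\<lambda>i. unit a0 a1 n i @ [a0]) [0..<n]"
  assume "polymorphism (Suc n) {unit a0 a1 n i @ [a0] | i. i < n} Q n ?f"
  then have "map (\<lambda>j. ?f (map (\<lambda>p. p ! j) ?ps)) [0..<Suc n] \<in> Q"
    unfolding polymorphism_def by (elim allE[of _ ?ps] mp) auto
  moreover have "map (\<lambda>j. ?f (map (\<lambda>p. p ! j) ?ps)) [0..<Suc n] = replicate n e @ [z]"
  proof -
    have "?f (map (\<lambda>p. p ! j) ?ps) = e" if "j < n" for j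
    proof -
      have "map (\<lambda>p. p ! j) ?ps = unit a0 a1 n j"
        using that by (intro nth_equalityI) (auto simp: unit_def nth_append nth_list_update)
      then show ?thesis using that by (auto simp: unit_ind_def simp del: map_map)
    qed
    then have "map (\<lambda>j. ?f (map (\<lambda>p. p ! j) ?ps)) [0..<n] = replicate n e"
      by (intro nth_equalityI) (simp_all del: map_map)
    moreover have "?f (map (\<lambda>p. p ! n) ?ps) = z"
    proof -
      have "map (\<lambda>p. p ! n) ?ps = replicate n a0"
        by (intro nth_equalityI) (auto simp: unit_def nth_append)
      moreover have "replicate n a0 \<noteq> unit a0 a1 n i" if "i < n" for i
        using that a by (auto simp: unit_def list_eq_iff_nth_eq)
      ultimately show ?thesis by (auto simp: unit_ind_def simp del: map_map)
    qed
    ultimately show ?thesis by (simp del: map_map)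
  qed
  ultimately show False using Q by (simp only:)
qed

text \<open>\<open>Q\<close> is the subalgebra generated by the tuples \<open>y @ [z]\<close>. A
  term operation producing \<open>replicate n e @ [z]\<close> would send the constant tuple
  \<open>z\<close> to \<open>z\<close>, by the last row. Each generator has an entry
  \<open>z\<close> in some other row, where the value is \<open>e\<close>; so the operation would
  escape.\<close>

lemma separating_relation:
  fixes z e :: 'b
  assumes ne: "\<not> escapes F z e" and B: "z \<noteq> e" "\<And>x. x = z \<or> x = e" and n: "n \<ge> 1"
  obtains Q where "\<And>l h. (l, h) \<in> F \<Longrightarrow> polymorphism (Suc n) Q Q l h"
    "\<And>y. length y = n \<Longrightarrow> y \<noteq> replicate n e \<Longrightarrow> y @ [z] \<in> Q" "replicate n e @ [z] \<notin> Q"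
proof -
  have "(UNIV :: 'b set) = {z, e}" using B(2) by auto
  then have "finite (UNIV :: 'b set)" by (metis finite.emptyI finite.insertI)
  then have "finite (tuples n - {replicate n e})" by (simp add: finite_tuples)
  from finite_list[OF this] obtain ys where ys: "set ys = tuples n - {replicate n e}" by (rule exE)
  define k where "k = length ys"
  \<comment> \<open>The rows of the matrix whose columns are the generators.\<close>
  define xs where "xs = map (\<lambda>j. map (\<lambda>y. (y @ [z]) ! j) ys) [0..<Suc n]"
  define Q where "Q = {map g xs | g. (k, g) \<in> term_ops F}"
  have "replicate n z \<in> set ys" using ys n B(1) by (simp add: replicate_eq_replicate)
  from length_pos_if_in_set[OF this] have k: "k \<ge> 1" by (simp add: k_def Suc_le_eq)
  have xs: "length xs = Suc n" "set xs \<subseteq> tuples k" by (auto simp: xs_def k_def)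
  show thesis
  proof (rule that)
    show "polymorphism (Suc n) Q Q l h" if "(l, h) \<in> F" for l h
      unfolding xs(1)[symmetric]
      using term_ops.comp[OF k] that xs(2) Q_def by (rule polymorphism_values)
  next
    fix y assume "length y = n" "y \<noteq> replicate n e"
    then have "y \<in> set ys" using ys by simp
    then obtain i where i: "i < k" "ys ! i = y" by (auto simp: in_set_conv_nth k_def)
    have "map (\<lambda>x\<in>tuples k. x ! i) xs = map (\<lambda>j. (y @ [z]) ! j) [0..<Suc n]"
      using i by (intro nth_equalityI) (auto simp: xs_def k_def simp del: upt_Suc)
    also have "\<dots> = y @ [z]"
      using \<open>length y = n\<close> by (intro nth_equalityI) (auto simp del: upt_Suc)
    finally show "y @ [z] \<in> Q"
      unfolding Q_def using term_ops.proj[OF i(1), of F] by (metis (mono_tags, lifting) mem_Collect_eq)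
  next
    show "replicate n e @ [z] \<notin> Q"
    proof
      assume "replicate n e @ [z] \<in> Q"
      then obtain t where t: "(k, t) \<in> term_ops F" "map t xs = replicate n e @ [z]"
        by (auto simp: Q_def)
      have tx: "t (xs ! j) = (replicate n e @ [z]) ! j" if "j < Suc n" for j
        using that xs(1) arg_cong[OF t(2), of "\<lambda>ws. ws ! j"] by simp
      have xsj: "xs ! j = map (\<lambda>y. (y @ [z]) ! j) ys" if "j < Suc n" for j
        using that by (simp add: xs_def del: upt_Suc)
      have "map (\<lambda>y. (y @ [z]) ! n) ys = map (\<lambda>_. z) ys"
        using ys by (intro map_cong) (auto simp: nth_append)
      then have "xs ! n = replicate k z"
        unfolding xsj[OF lessI] by (simp only: map_replicate_const k_def)
      then have "t (replicate k z) = z" using tx[of n] by (simp add: nth_append)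
      moreover have "\<exists>\<rho>. length \<rho> = k \<and> t \<rho> = e \<and> \<rho> ! i = z" if i: "i < k" for i
      proof -
        have "ys ! i \<in> set ys" using i by (simp add: k_def)
        then have y: "length (ys ! i) = n" "ys ! i \<noteq> replicate n e" unfolding ys by simp_all
        then obtain j where j: "j < n" "ys ! i ! j \<noteq> e" by (auto simp: list_eq_iff_nth_eq)
        then have "ys ! i ! j = z" using B(2) by blast
        then have "xs ! j ! i = z" using xsj[of j] j i y by (simp add: k_def nth_append)
        moreover have "t (xs ! j) = e" using tx[of j] j by (simp add: nth_append)
        moreover have "length (xs ! j) = k" using xsj[of j] j by (simp add: k_def)
        ultimately show ?thesis by blast
      qed
      ultimately have "escapes F z e" using t(1) by (auto simp: escapes_def)
      with ne show False ..
    qed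
  qed
qed

text \<open>\<open>C S\<close> contains the \<open>unit_ind\<close> of arity \<open>Suc m\<close>
  exactly for \<open>m\<close> outside \<open>S\<close>, so distinct sets of naturals give distinct
  clonoids. The shift by one avoids arity 0.\<close>

lemma reals_lepoll_clonoids:
  fixes z e :: 'b and a0 a1 :: 'a
  assumes ne: "\<not> escapes F z e" and B: "z \<noteq> e" "\<And>x. x = z \<or> x = e" and a: "a0 \<noteq> a1"
  shows "(UNIV :: real set) \<lesssim> (clonoids F :: (nat \<times> ('a list \<Rightarrow> 'b)) set set)"
proof -
  have "\<exists>Q. (\<forall>l h. (l, h) \<in> F \<longrightarrow> polymorphism (Suc n) Q Q l h) \<and>
      (\<forall>y. length y = n \<longrightarrow> y \<noteq> replicate n e \<longrightarrow> y @ [z] \<in> Q) \<and> replicate n e @ [z] \<notin> Q"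
    if "n \<ge> 1" for n
    by (rule separating_relation[OF ne B that]) blast
  then obtain Q where Q: "\<And>n l h. n \<ge> 1 \<Longrightarrow> (l, h) \<in> F \<Longrightarrow> polymorphism (Suc n) (Q n) (Q n) l h"
    "\<And>n y. n \<ge> 1 \<Longrightarrow> length y = n \<Longrightarrow> y \<noteq> replicate n e \<Longrightarrow> y @ [z] \<in> Q n"
    "\<And>n. n \<ge> 1 \<Longrightarrow> replicate n e @ [z] \<notin> Q n"
    by metis
  define R where "R n = (Suc n, {unit a0 a1 n i @ [a0] | i. i < n}, Q n)" for n
  define C where "C S = Pol ((\<lambda>n. R (Suc n)) ` S)" for S
  have C_clonoid: "C S \<in> clonoids F" for S
    unfolding C_def clonoids_def mem_Collect_eq
    by (rule clonoid_Pol) (use Q(1) in \<open>auto simp: R_def\<close>)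
  have C_iff: "(Suc m, unit_ind a0 a1 z e (Suc m)) \<in> C S \<longleftrightarrow> m \<notin> S" for m S
  proof
    assume "(Suc m, unit_ind a0 a1 z e (Suc m)) \<in> C S"
    then show "m \<notin> S"
      using not_polymorphism_unit_ind[OF a Q(3)[of "Suc m"]] by (force simp: C_def Pol_def R_def)
  next
    assume "m \<notin> S"
    then have "polymorphism (Suc (Suc n)) {unit a0 a1 (Suc n) i @ [a0] | i. i < Suc n} (Q (Suc n))
        (Suc m) (unit_ind a0 a1 z e (Suc m))" if "n \<in> S" for n
      using that by (intro polymorphism_unit_ind[OF a B]) (auto intro: Q(2))
    moreover have "(Suc m, unit_ind a0 a1 z e (Suc m)) \<in> finitary_functions"
      unfolding unit_ind_def by (rule restrict_in_finitary_functions) simp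
    ultimately show "(Suc m, unit_ind a0 a1 z e (Suc m)) \<in> C S"
      by (auto simp: C_def Pol_def R_def)
  qed
  have "inj C"
  proof (rule injI)
    fix S S' assume "C S = C S'"
    then have "m \<notin> S \<longleftrightarrow> m \<notin> S'" for m using C_iff by metis
    then show "S = S'" by blast
  qed
  then have "(UNIV :: nat set set) \<lesssim> (clonoids F :: (nat \<times> ('a list \<Rightarrow> 'b)) set set)"
    using C_clonoid unfolding lepoll_def by blast
  then show ?thesis
    using nat_sets_eqpoll_reals by (meson eqpoll_sym lepoll_trans1)
qed

subsection \<open>The classification\<close>

lemma finite_bounded_relation_pairs:
  assumes "finite (UNIV :: 'b set)"
  shows "finite (SIGMA m:{1..n}. Pow (tuples m) \<times> Pow (tuples m) ::
    (nat \<times> 'a::finite list set \<times> 'b list set) set)"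
  using assms by (intro finite_SigmaI finite_cartesian_product) (auto simp: finite_tuples)

lemma finitely_related_if_Pol_graph_pairs:
  fixes C :: "(nat \<times> ('a::finite list \<Rightarrow> 'b)) set"
  assumes "finite (UNIV :: 'b set)" and C: "Pol (graph_pairs C n) = C"
  shows "finitely_related C"
  unfolding finitely_related_def
proof (intro exI conjI)
  show "finite (graph_pairs C n)"
    using finite_bounded_relation_pairs[OF assms(1)] graph_pairs_bounded by (rule finite_subset[rotated])
  show "graph_pairs C n \<subseteq> relation_pairs"
    using graph_pairs_bounded[of C n] by (auto simp: relation_pairs_def)
  show "C = Pol (graph_pairs C n)" by (rule C[symmetric])
qed

lemma countable_relation_pairs:
  assumes "finite (UNIV :: 'b set)"
  shows "countable (relation_pairs :: (nat \<times> 'a::finite list set \<times> 'b list set) set)"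
proof -
  have "countable (SIGMA m:UNIV. Pow (tuples m) \<times> Pow (tuples m) ::
      (nat \<times> 'a list set \<times> 'b list set) set)"
    using assms
    by (intro countable_SIGMA countable_finite[OF finite_cartesian_product]) (auto simp: finite_tuples)
  then show ?thesis by (rule countable_subset[rotated]) (auto simp: relation_pairs_def)
qed

lemma countable_clonoids_if_finitely_related:
  assumes "finite (UNIV :: 'b set)"
    and fr: "\<And>C :: (nat \<times> ('a::finite list \<Rightarrow> 'b)) set. C \<in> clonoids F \<Longrightarrow> finitely_related C"
  shows "countable (clonoids F :: (nat \<times> ('a list \<Rightarrow> 'b)) set set)"
proof -
  have "clonoids F \<subseteq>
      Pol ` {R. finite R \<and> R \<subseteq> (relation_pairs :: (nat \<times> 'a list set \<times> 'b list set) set)}"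
    using fr unfolding finitely_related_def by blast
  moreover have "countable {R. finite R \<and> R \<subseteq> (relation_pairs :: (nat \<times> 'a list set \<times> 'b list set) set)}"
    by (rule countable_Collect_finite_subset[OF countable_relation_pairs[OF assms(1)]])
  ultimately show ?thesis by (meson countable_image countable_subset)
qed

text \<open>The bound \<open>d\<close> depends on the term alone, so all clonoids arise from subsets
  of one finite set of pairs.\<close>

lemma nu_clonoids:
  fixes F :: "(nat \<times> ('b list \<Rightarrow> 'b)) set"
  assumes fin: "finite (UNIV :: 'b set)" and nu: "has_nu_term F"
  shows "finite (clonoids F :: (nat \<times> ('a::finite list \<Rightarrow> 'b)) set set)"
    and "C \<in> clonoids F \<Longrightarrow> finitely_related (C :: (nat \<times> ('a list \<Rightarrow> 'b)) set)"
proof -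
  obtain k t where t: "(k, t) \<in> term_ops F" "nu_operation k t"
    using nu by (auto simp: has_nu_term_def)
  then have "k \<noteq> 0" by (simp add: nu_operation_def)
  then obtain d where k: "k = Suc d" by (rule not0_implies_Suc[THEN exE])
  have C: "Pol (graph_pairs C d) = C" if "C \<in> clonoids F" for C :: "(nat \<times> ('a list \<Rightarrow> 'b)) set"
    using that t unfolding k clonoids_def by (intro Pol_graph_pairs_nu) auto
  let ?W = "SIGMA m:{1..d}. Pow (tuples m) \<times> Pow (tuples m) :: (nat \<times> 'a list set \<times> 'b list set) set"
  have "(clonoids F :: (nat \<times> ('a list \<Rightarrow> 'b)) set set) \<subseteq> Pol ` Pow ?W"
  proof
    fix C :: "(nat \<times> ('a list \<Rightarrow> 'b)) set" assume "C \<in> clonoids F"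
    then have "C = Pol (graph_pairs C d)" by (simp add: C)
    then show "C \<in> Pol ` Pow ?W" using graph_pairs_bounded by blast
  qed
  moreover have "finite (Pow ?W)" using finite_bounded_relation_pairs[OF fin] by (simp only: finite_Pow_iff)
  ultimately show "finite (clonoids F :: (nat \<times> ('a list \<Rightarrow> 'b)) set set)"
    by (meson finite_imageI finite_subset)
  show "finitely_related C" if "C \<in> clonoids F" for C :: "(nat \<times> ('a list \<Rightarrow> 'b)) set"
    by (rule finitely_related_if_Pol_graph_pairs[OF fin C[OF that]])
qed

lemma malcev_clonoids_finitely_related:
  fixes F :: "(nat \<times> ('b list \<Rightarrow> 'b)) set" and C :: "(nat \<times> ('a::finite list \<Rightarrow> 'b)) set"
  assumes two: "CARD('b) = 2" and mal: "has_malcev_term F" and C: "C \<in> clonoids F"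
  shows "finitely_related C"
proof -
  have fin: "finite (UNIV :: 'b set)" using two by (metis card.infinite zero_neq_numeral)
  from malcev_majority_or_minority[OF two mal] show ?thesis
  proof
    assume "has_majority_term F"
    then show ?thesis using C by (intro nu_clonoids(2)[OF fin has_nu_term_if_majority])
  next
    assume "term3 F minority"
    then obtain n where "Pol (graph_pairs C n) = C"
      using Pol_graph_pairs_minority[OF two] C unfolding clonoids_def by blast
    then show ?thesis by (rule finitely_related_if_Pol_graph_pairs[OF fin])
  qed
qed

lemma malcev_no_majority_infinite:
  fixes F :: "(nat \<times> ('b list \<Rightarrow> 'b)) set"
  assumes A: "CARD('a) > 1" and two: "CARD('b) = 2"
    and mal: "has_malcev_term F" and nm: "\<not> has_majority_term F"
  shows "infinite (clonoids F :: (nat \<times> ('a::finite list \<Rightarrow> 'b)) set set)"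
proof -
  obtain z e :: 'b where B: "z \<noteq> e" "\<And>x. x = z \<or> x = e" using card_2_elements[OF two] by blast
  obtain a0 a1 :: 'a where a: "a0 \<noteq> a1"
    using A card_le_Suc0_iff_eq[of "UNIV :: 'a set"] by auto
  have mi: "term3 F minority" using malcev_majority_or_minority[OF two mal] nm by blast
  show ?thesis
  proof (rule infinite_clonoids_if_preserve_minority[OF B a])
    fix n g and xs ys ws :: "'b list"
    assume g: "(n, g) \<in> F" and len: "length xs = n" "length ys = n" "length ws = n"
    show "g (map (\<lambda>i. minority (xs ! i) (ys ! i) (ws ! i)) [0..<n]) = minority (g xs) (g ys) (g ws)"
    proof (cases "n = 0")
      \<comment> \<open>A nullary operation is not itself in \<open>term_ops\<close>. Here all the
        tuples are empty, and the minority is idempotent.\<close>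
      case True
      then show ?thesis using len by (simp add: minority_def)
    next
      case False
      then have "(n, restrict g (tuples n)) \<in> term_ops F"
        using term_fn_basic[OF g] unfolding term_fn_def by simp
      from term_ops_preserve_minority[OF two mi nm this len] show ?thesis using len by simp
    qed
  qed
qed

lemma no_nu_no_malcev_continuum:
  fixes F :: "(nat \<times> ('b list \<Rightarrow> 'b)) set"
  assumes A: "CARD('a) > 1" and two: "CARD('b) = 2"
    and "\<not> has_nu_term F" "\<not> has_malcev_term F"
  shows "(clonoids F :: (nat \<times> ('a::finite list \<Rightarrow> 'b)) set set) \<approx> (UNIV :: real set)"
proof -
  obtain z e :: 'b where B: "z \<noteq> e" "\<And>x. x = z \<or> x = e" using card_2_elements[OF two] by blast
  then have B': "e \<noteq> z" "\<And>x. x = e \<or> x = z" by auto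
  obtain a0 a1 :: 'a where a: "a0 \<noteq> a1"
    using A card_le_Suc0_iff_eq[of "UNIV :: 'a set"] by auto
  have fin: "finite (UNIV :: 'b set)" using two by (metis card.infinite zero_neq_numeral)
  have "\<not> escapes F z e \<or> \<not> escapes F e z"
    using nu_or_malcev_if_escapes[OF B] assms(3,4) by blast
  then have "(UNIV :: real set) \<lesssim> (clonoids F :: (nat \<times> ('a list \<Rightarrow> 'b)) set set)"
    using reals_lepoll_clonoids[OF _ B a] reals_lepoll_clonoids[OF _ B' a] by blast
  then show ?thesis using clonoids_lepoll_reals[OF fin] by (intro lepoll_antisym)
qed

theorem theorem1p3:
  fixes F :: "(nat \<times> ('b list \<Rightarrow> 'b)) set"
    and CC :: "(nat \<times> ('a::finite list \<Rightarrow> 'b)) set set"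
  assumes "CARD('a) > 1"
    and "CARD('b) = 2"
    and "algebra_ops F"
  defines "CC \<equiv> clonoids F"
  shows "(finite CC \<longleftrightarrow> has_nu_term F) \<and>
    (countable CC \<and> infinite CC \<longleftrightarrow> has_malcev_term F \<and> \<not> has_majority_term F) \<and>
    (CC \<approx> (UNIV :: real set) \<longleftrightarrow> \<not> has_nu_term F \<and> \<not> has_malcev_term F) \<and>
    (finite CC \<or> (countable CC \<and> infinite CC) \<longrightarrow> (\<forall>C\<in>CC. finitely_related C))"
proof -
  have fin: "finite (UNIV :: 'b set)" using assms(2) by (metis card.infinite zero_neq_numeral)
  have nu: "finite CC" "\<forall>C\<in>CC. finitely_related C" if "has_nu_term F"
    using nu_clonoids[OF fin that] by (auto simp: CC_def)
  have mal: "\<forall>C\<in>CC. finitely_related C" if "has_malcev_term F"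
    using malcev_clonoids_finitely_related[OF assms(2) that] by (auto simp: CC_def)
  then have mal_c: "countable CC" if "has_malcev_term F"
    using that countable_clonoids_if_finitely_related[OF fin] unfolding CC_def by blast
  have inf: "infinite CC" if "has_malcev_term F" "\<not> has_majority_term F"
    using malcev_no_majority_infinite[OF assms(1,2) that] by (simp add: CC_def)
  have cont: "CC \<approx> (UNIV :: real set)" if "\<not> has_nu_term F" "\<not> has_malcev_term F"
    using no_nu_no_malcev_continuum[OF assms(1,2) that] by (simp add: CC_def)
  have unc: "\<not> countable CC" if "CC \<approx> (UNIV :: real set)"
    using that uncountable_UNIV_real by (metis countable_lepoll eqpoll_imp_lepoll eqpoll_sym)
  have maj: "has_nu_term F" if "has_majority_term F" using that by (rule has_nu_term_if_majority)
  \<comment> \<open>The three conditions on terms cover all cases, as a majority term is a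
    near-unanimity term, and the three sizes exclude each other. This gives the converse
    implications.\<close>
  show ?thesis
    using nu mal mal_c inf cont unc maj countable_finite[of CC] by blast
qed

end
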